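(* Let $\alpha,\beta,\gamma\in[0,1]$ with $\alpha\ge\gamma$, and let $\mathcal{K}(n,\mathbf{P})$ be the Kronecker graph defined in the context. If either $\beta+\gamma>1$, or $\beta=1$, $\alpha>0$ and $\gamma=0$, then there exists a constant $a=a(\alpha,\beta,\gamma)$ such that asymptotically almost surely (i.e. with probability tending to $1$ as $n\to\infty$) $\operatorname{diam}(\mathcal{K}(n,\mathbf{P}))\le a$.
   Context: Let $\mathbf{P}$ be the symmetric $2\times 2$ matrix with rows and columns indexed by $1,0$, with $\mathbf{P}[1,1]=\alpha$, $\mathbf{P}[1,0]=\mathbf{P}[0,1]=\beta$, $\mathbf{P}[0,0]=\gamma$, where $\alpha,\beta,\gamma\in[0,1]$ and $\alpha\ge\gamma$. The Kronecker graph $\mathcal{K}(n,\mathbf{P})$ is the random graph with vertex set $\{0,1\}^n$ in which two distinct vertices $u=(u_1,\dots,u_n)$ and $v=(v_1,\dots,v_n)$ are adjacent with probability $\prod_{i=1}^n\mathbf{P}[u_i,v_i]$, independently for each pair. The diameter is the maximum graph distance between two vertices (infinite if the graph is disconnected). *)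

theory Defs
  imports "HOL-Probability.Probability" "Graph_Theory.Graph_Theory"
begin

definition kron_matrix :: "real \<Rightarrow> real \<Rightarrow> real \<Rightarrow> nat \<Rightarrow> nat \<Rightarrow> real" where
  "kron_matrix \<alpha> \<beta> \<gamma> i j =
     (if i = 1 \<and> j = 1 then \<alpha> else if i = 0 \<and> j = 0 then \<gamma> else \<beta>)"

definition kron_verts :: "nat \<Rightarrow> (nat \<Rightarrow> nat) set" where
  "kron_verts n = {1..n} \<rightarrow>\<^sub>E {0, 1}"

definition kron_pairs :: "nat \<Rightarrow> (nat \<Rightarrow> nat) set set" where
  "kron_pairs n = {{u, v} | u v. u \<in> kron_verts n \<and> v \<in> kron_verts n \<and> u \<noteq> v}"

(* The probability attached to an unordered pair e; for symmetric P it does not depend on how e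
   is written as {u, v}, see kron_prob_doubleton below. *)
definition kron_prob :: "nat \<Rightarrow> (nat \<Rightarrow> nat \<Rightarrow> real) \<Rightarrow> (nat \<Rightarrow> nat) set \<Rightarrow> real" where
  "kron_prob n P e = (THE p. \<exists>u v. e = {u, v} \<and> p = (\<Prod>i\<in>{1..n}. P (u i) (v i)))"

(* The law of the random graph: one independent coin per unordered pair of distinct vertices.
   An undirected edge is represented by its two opposite arcs. *)
definition kronecker_graph ::
    "nat \<Rightarrow> (nat \<Rightarrow> nat \<Rightarrow> real) \<Rightarrow> (nat \<Rightarrow> nat) pair_pre_digraph pmf" where
  "kronecker_graph n P =
     map_pmf
       (\<lambda>X. \<lparr>pverts = kron_verts n,
             parcs = {(u, v). u \<in> kron_verts n \<and> v \<in> kron_verts n \<and> u \<noteq> v \<and> X {u, v}}\<rparr>)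
       (Pi_pmf (kron_pairs n) False (\<lambda>e. bernoulli_pmf (kron_prob n P e)))"

(* With unit weights the library's shortest-path cost is the graph distance; it is infinite if
   there is no walk. *)
definition graph_dist :: "('a, 'b) pre_digraph \<Rightarrow> 'a \<Rightarrow> 'a \<Rightarrow> ereal" where
  "graph_dist G u v = wf_digraph.\<mu> G (\<lambda>_. 1) u v"

definition graph_diam :: "('a, 'b) pre_digraph \<Rightarrow> ereal" where
  "graph_diam G = (SUP u\<in>verts G. SUP v\<in>verts G. graph_dist G u v)"

lemma kron_matrix_sym: "kron_matrix \<alpha> \<beta> \<gamma> i j = kron_matrix \<alpha> \<beta> \<gamma> j i"
  by (auto simp: kron_matrix_def)

lemma kron_prob_doubleton:
  assumes "\<And>i j. P i j = P j i"
  shows "kron_prob n P {u, v} = (\<Prod>i\<in>{1..n}. P (u i) (v i))"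
  unfolding kron_prob_def
proof (rule the_equality)
  fix p assume "\<exists>u' v'. {u, v} = {u', v'} \<and> p = (\<Prod>i\<in>{1..n}. P (u' i) (v' i))"
  then obtain u' v' where "{u, v} = {u', v'}" and p: "p = (\<Prod>i\<in>{1..n}. P (u' i) (v' i))"
    by blast
  then consider "u' = u" "v' = v" | "u' = v" "v' = u"
    by (auto simp: doubleton_eq_iff)
  then show "p = (\<Prod>i\<in>{1..n}. P (u i) (v i))"
    by cases (use p assms in \<open>auto intro!: prod.cong\<close>)
qed blast

lemma finite_kron_verts: "finite (kron_verts n)"
  by (simp add: kron_verts_def finite_PiE)

lemma finite_kron_pairs: "finite (kron_pairs n)"
  by (rule finite_subset[of _ "Pow (kron_verts n)"])
     (auto simp: kron_pairs_def finite_kron_verts)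

lemma kronecker_graph_pair_graph:
  assumes "G \<in> set_pmf (kronecker_graph n P)"
  shows "pair_graph G"
proof -
  obtain X where G: "G = \<lparr>pverts = kron_verts n,
      parcs = {(u, v). u \<in> kron_verts n \<and> v \<in> kron_verts n \<and> u \<noteq> v \<and> X {u, v}}\<rparr>"
    using assms by (auto simp: kronecker_graph_def)
  have "finite (parcs G)"
    by (rule finite_subset[of _ "kron_verts n \<times> kron_verts n"])
       (auto simp: G finite_kron_verts)
  then show ?thesis
    by unfold_locales
       (auto simp: G finite_kron_verts insert_commute symmetric_def arcs_ends_def arc_to_ends_def intro!: symI)
qed

lemma graph_dist_eq:
  assumes "wf_digraph G"
  shows "graph_dist G u v = (INF p\<in>{p. pre_digraph.awalk G u p v}. ereal (real (length p)))"
  by (simp add: graph_dist_def wf_digraph.\<mu>_def[OF assms] wf_digraph.awalk_cost_def[OF assms]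
      sum_list_triv cong: INF_cong)

end

theory Submission
  imports Defs
begin

text \<open>
  Every vertex is joined to the all-ones vertex by a walk of constant length \<open>L\<close>, with failure
  probability \<open>O(4\<^sup>-\<^sup>n)\<close>, so that a union bound over the \<open>2\<^sup>n\<close> vertices gives the diameter.
  Let the \<open>i\<close>-th coordinates of the counted walks range over a set \<open>Z\<^sub>i\<close> of binary walks. Then the first two
  moments of the number of walks present in the graph factorise over the coordinates: the first is
  \<open>\<Prod>\<^sub>i W\<^sub>i\<close>, and the second is at most the sum over the sets \<open>T\<close> of times of \<open>\<Prod>\<^sub>i S\<^sub>i(T)\<close>, where \<open>S\<^sub>i(T)\<close>
  counts the pairs of binary walks that agree on the steps in \<open>T\<close>. It is thus enough that
  \<open>S\<^sub>i(T) \<le> \<theta> W\<^sub>i\<^sup>2\<close> with \<open>\<theta> < 1\<close> for \<open>T \<noteq> {}\<close> and a positive proportion of the coordinates; Chebyshev then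
  gives an exponentially small failure probability. A constant number of independent attempts, kept
  disjoint by a bounded number of label coordinates, makes it smaller than \<open>4\<^sup>-\<^sup>n\<close>.

  If \<open>\<beta> + \<gamma> > 1\<close>, lower \<open>\<alpha>\<close> to \<open>\<gamma>\<close>: the matrix then has constant row sums \<open>\<beta> + \<gamma>\<close>, hence a constant
  Perron vector, and for all binary walks \<open>S(T) / W\<^sup>2\<close> exceeds \<open>1 / (\<beta> + \<gamma>)\<close> by little once \<open>L\<close> is large.
  If \<open>\<beta> = 1\<close> and \<open>\<gamma> = 0\<close>, every vertex is adjacent to its complement, so one may start at a vertex
  with at least \<open>n / 2\<close> ones; a coordinate equal to one alternates and pauses exactly once, at one of
  \<open>k > 1 / \<alpha>\<close> times, and \<open>W = k \<alpha>\<close>.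
\<close>

section \<open>Independent coins and the second moment\<close>

lemma prob_all_Pi_bernoulli:
  assumes "finite E" "S \<subseteq> E" "\<And>e. e \<in> E \<Longrightarrow> 0 \<le> p e \<and> p e \<le> 1"
  shows "measure_pmf.prob (Pi_pmf E d (\<lambda>e. bernoulli_pmf (p e))) {X. \<forall>e\<in>S. X e} = (\<Prod>e\<in>S. p e)"
proof -
  let ?B = "\<lambda>e. if e \<in> S then {True} else UNIV"
  have "{X. \<forall>e\<in>S. X e} = Pi E ?B"
    using assms(2) by (auto simp: Pi_def split: if_splits)
  then have "measure_pmf.prob (Pi_pmf E d (\<lambda>e. bernoulli_pmf (p e))) {X. \<forall>e\<in>S. X e}
      = (\<Prod>e\<in>E. measure_pmf.prob (bernoulli_pmf (p e)) (?B e))"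
    by (simp only: measure_Pi_pmf_Pi[OF assms(1)])
  also have "\<dots> = (\<Prod>e\<in>E. if e \<in> S then p e else 1)"
    using assms(3) by (intro prod.cong) (auto simp: measure_pmf_single)
  also have "\<dots> = (\<Prod>e\<in>S. p e)"
    using assms(1,2) by (simp add: prod.If_cases Int_absorb1)
  finally show ?thesis .
qed

text \<open>Restrictions of independent coins to disjoint index sets are independent, and by
  \<open>dep\<close> each \<open>A j\<close> is a preimage under the restriction to
  \<open>D j\<close>. This later multiplies the failure probabilities of edge-disjoint families of
  walks.\<close>

lemma Pi_pmf_prob_Int_indep:
  fixes A :: "'i \<Rightarrow> ('a \<Rightarrow> bool) set"
  assumes E: "finite E" and J: "finite J" "J \<noteq> {}" and D: "\<And>j. j \<in> J \<Longrightarrow> D j \<subseteq> E"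
    and disj: "disjoint_family_on D J"
    and dep: "\<And>j X Y. \<lbrakk>j \<in> J; X \<in> A j; \<forall>e\<in>D j. X e = Y e\<rbrakk> \<Longrightarrow> Y \<in> A j"
  shows "measure_pmf.prob (Pi_pmf E d q) (\<Inter>j\<in>J. A j) = (\<Prod>j\<in>J. measure_pmf.prob (Pi_pmf E d q) (A j))"
proof -
  let ?M = "measure_pmf (Pi_pmf E d q)"
  have iv: "prob_space.indep_vars ?M (\<lambda>j. PiM (D j) (\<lambda>_. count_space UNIV)) (\<lambda>j X. restrict (\<lambda>e. X e) (D j)) J"
    by (rule prob_space.indep_vars_restrict[OF measure_pmf.prob_space_axioms indep_vars_Pi_pmf[OF E] D disj])
  have A: "A j = (\<lambda>X. restrict (\<lambda>e. X e) (D j)) -` ((\<lambda>X. restrict X (D j)) ` A j) \<inter> space ?M"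
    if "j \<in> J" for j
  proof (intro equalityI subsetI)
    fix Y assume "Y \<in> (\<lambda>X. restrict (\<lambda>e. X e) (D j)) -` ((\<lambda>X. restrict X (D j)) ` A j) \<inter> space ?M"
    then obtain X where X: "X \<in> A j" "restrict Y (D j) = restrict X (D j)" by auto
    have "\<forall>e\<in>D j. X e = Y e" using X(2) by (metis restrict_apply')
    then show "Y \<in> A j" using dep[OF that X(1)] by blast
  qed auto
  have B: "(\<lambda>X. restrict X (D j)) ` A j \<in> sets (PiM (D j) (\<lambda>_. count_space UNIV))" if "j \<in> J" for j
  proof -
    have fin: "finite (D j)" using D[OF that] E by (rule finite_subset)
    \<comment> \<open>Since \<open>D j\<close> is finite, the product sigma-algebra is discrete and
      every set is measurable.\<close>
    have "PiM (D j) (\<lambda>_. count_space (UNIV :: bool set)) = count_space (PiE (D j) (\<lambda>_. UNIV))"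
      by (rule count_space_PiM_finite) (use fin in auto)
    then show ?thesis by auto
  qed
  have "measure ?M (\<Inter>j\<in>J. (\<lambda>X. restrict (\<lambda>e. X e) (D j)) -` ((\<lambda>X. restrict X (D j)) ` A j) \<inter> space ?M)
      = (\<Prod>j\<in>J. measure ?M ((\<lambda>X. restrict (\<lambda>e. X e) (D j)) -` ((\<lambda>X. restrict X (D j)) ` A j) \<inter> space ?M))"
    by (rule prob_space.indep_varsD[OF measure_pmf.prob_space_axioms iv J(2,1)]) (use B in auto)
  then show ?thesis using A by simp
qed

text \<open>Weighting a walk by \<open>q / p\<close> on each of its edges replaces the edge probability \<open>p\<close> by any smaller \<open>q\<close>
  without a coupling of two random graphs.\<close>

lemma second_moment_walks:
  fixes \<Omega> :: "'w set" and e :: "'w \<Rightarrow> nat \<Rightarrow> 'a" and q :: "'w \<Rightarrow> nat \<Rightarrow> real"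
  assumes E: "finite E" and p: "\<And>x. x \<in> E \<Longrightarrow> 0 \<le> p x \<and> p x \<le> 1"
    and \<Omega>: "finite \<Omega>"
    and eE: "\<And>\<omega> t. \<lbrakk>\<omega> \<in> \<Omega>; t < L\<rbrakk> \<Longrightarrow> e \<omega> t \<in> E"
    and layers: "\<And>\<omega> \<omega>' t t'. \<lbrakk>\<omega> \<in> \<Omega>; \<omega>' \<in> \<Omega>; t < L; t' < L; t \<noteq> t'\<rbrakk> \<Longrightarrow> e \<omega> t \<noteq> e \<omega>' t'"
    and q: "\<And>\<omega> t. \<lbrakk>\<omega> \<in> \<Omega>; t < L\<rbrakk> \<Longrightarrow> 0 \<le> q \<omega> t \<and> q \<omega> t \<le> p (e \<omega> t)"
    and pos: "(\<Sum>\<omega>\<in>\<Omega>. \<Prod>t<L. q \<omega> t) > 0"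
  shows "measure_pmf.prob (Pi_pmf E d (\<lambda>x. bernoulli_pmf (p x))) {X. \<forall>\<omega>\<in>\<Omega>. \<exists>t<L. \<not> X (e \<omega> t)}
    \<le> (\<Sum>T\<in>Pow {..<L} - {{}}. \<Sum>\<omega>\<in>\<Omega>. \<Sum>\<omega>'\<in>\<Omega>.
          \<Prod>t<L. if t \<in> T then of_bool (e \<omega> t = e \<omega>' t) * q \<omega> t else q \<omega> t * q \<omega>' t)
       / (\<Sum>\<omega>\<in>\<Omega>. \<Prod>t<L. q \<omega> t)\<^sup>2"
proof -
  define M where "M = Pi_pmf E d (\<lambda>x. bernoulli_pmf (p x))"
  define \<mu> where "\<mu> = (\<Sum>\<omega>\<in>\<Omega>. \<Prod>t<L. q \<omega> t)"
  \<comment> \<open>The weight \<open>c \<omega>\<close> turns the probability that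
    \<open>\<omega>\<close> is present into the product of the \<open>q\<close>, so the weighted
    count \<open>N\<close> below has mean \<open>\<mu>\<close>.\<close>
  define c where "c = (\<lambda>\<omega>. \<Prod>t<L. q \<omega> t / p (e \<omega> t))"
  define I where "I = (\<lambda>\<omega>. {X. \<forall>x\<in>e \<omega> ` {..<L}. X x})"
  define N where "N = (\<lambda>X. \<Sum>\<omega>\<in>\<Omega>. c \<omega> * indicat_real (I \<omega>) X)"
  have int: "integrable (measure_pmf M) (\<lambda>X. indicat_real A X)" for A
    by (rule measure_pmf.integrable_const_bound[where B = 1]) (auto simp: indicator_def)
  have inj: "inj_on (e \<omega>) {..<L}" if "\<omega> \<in> \<Omega>" for \<omega>
    using layers[OF that that] by (auto simp: inj_on_def)
  have E1: "c \<omega> * measure_pmf.prob M (I \<omega>) = (\<Prod>t<L. q \<omega> t)" if w: "\<omega> \<in> \<Omega>" for \<omega>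
  proof -
    have "measure_pmf.prob M (I \<omega>) = (\<Prod>x\<in>e \<omega> ` {..<L}. p x)"
      unfolding M_def I_def by (rule prob_all_Pi_bernoulli) (use E eE w p in auto)
    also have "\<dots> = (\<Prod>t<L. p (e \<omega> t))"
      by (simp add: prod.reindex[OF inj[OF w]])
    finally have "c \<omega> * measure_pmf.prob M (I \<omega>) = (\<Prod>t<L. q \<omega> t / p (e \<omega> t) * p (e \<omega> t))"
      unfolding c_def by (simp only: prod.distrib)
    also have "\<dots> = (\<Prod>t<L. q \<omega> t)"
      \<comment> \<open>Where \<open>p\<close> vanishes, so does \<open>q\<close>, and the quotient
        is 0 by the convention for division.\<close>
      by (intro prod.cong refl) (use q[OF w] in force)
    finally show ?thesis .
  qed
  \<comment> \<open>Time \<open>t\<close> involves one or two coins. A common coin contributes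
    \<open>q * q' / p\<close>, which is at most \<open>q\<close> because \<open>q' \<le> p\<close>.
    The bound is kept additive so that expanding the product over \<open>t\<close> gives a sum over
    the sets \<open>T\<close> of shared steps.\<close>
  have E2: "c \<omega> * c \<omega>' * measure_pmf.prob M (I \<omega> \<inter> I \<omega>') \<le> (\<Prod>t<L. q \<omega> t * q \<omega>' t + of_bool (e \<omega> t = e \<omega>' t) * q \<omega> t)"
    if w: "\<omega> \<in> \<Omega>" "\<omega>' \<in> \<Omega>" for \<omega> \<omega>'
  proof -
    have "I \<omega> \<inter> I \<omega>' = {X. \<forall>x\<in>(\<Union>t\<in>{..<L}. {e \<omega> t, e \<omega>' t}). X x}"
      by (auto simp: I_def)
    then have "measure_pmf.prob M (I \<omega> \<inter> I \<omega>') = (\<Prod>x\<in>(\<Union>t\<in>{..<L}. {e \<omega> t, e \<omega>' t}). p x)"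
      unfolding M_def by (simp only:) (rule prob_all_Pi_bernoulli, use E eE w p in auto)
    also have "\<dots> = (\<Prod>t<L. \<Prod>x\<in>{e \<omega> t, e \<omega>' t}. p x)"
      by (rule prod.UNION_disjoint) (use layers w in auto)
    finally have "c \<omega> * c \<omega>' * measure_pmf.prob M (I \<omega> \<inter> I \<omega>')
        = (\<Prod>t<L. (q \<omega> t / p (e \<omega> t)) * (q \<omega>' t / p (e \<omega>' t)) * (\<Prod>x\<in>{e \<omega> t, e \<omega>' t}. p x))"
      unfolding c_def by (simp only: prod.distrib)
    also have "\<dots> \<le> (\<Prod>t<L. q \<omega> t * q \<omega>' t + of_bool (e \<omega> t = e \<omega>' t) * q \<omega> t)"
    proof (rule prod_mono, safe)
      fix t assume t: "t < L"
      note a = q[OF w(1) t] q[OF w(2) t] p[OF eE[OF w(1) t]] p[OF eE[OF w(2) t]]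
      show "0 \<le> (q \<omega> t / p (e \<omega> t)) * (q \<omega>' t / p (e \<omega>' t)) * (\<Prod>x\<in>{e \<omega> t, e \<omega>' t}. p x)"
        using a by (cases "e \<omega> t = e \<omega>' t") auto
      show "(q \<omega> t / p (e \<omega> t)) * (q \<omega>' t / p (e \<omega>' t)) * (\<Prod>x\<in>{e \<omega> t, e \<omega>' t}. p x)
        \<le> q \<omega> t * q \<omega>' t + of_bool (e \<omega> t = e \<omega>' t) * q \<omega> t"
      proof (cases "e \<omega> t = e \<omega>' t")
        case True
        have "q \<omega> t * (q \<omega>' t / p (e \<omega>' t)) \<le> q \<omega> t * 1"
          using a by (intro mult_left_mono) (auto simp: divide_le_eq_1)
        moreover have "0 \<le> q \<omega> t * q \<omega>' t" using a by simp
        ultimately have "q \<omega> t * (q \<omega>' t / p (e \<omega>' t)) \<le> q \<omega> t * q \<omega>' t + q \<omega> t" by linarith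
        then show ?thesis using a True by (cases "p (e \<omega> t) = 0") auto
      next
        case False
        have "x / y * (x' / y') * (y * y') \<le> x * x'" if "0 \<le> x" "0 \<le> x'" for x y x' y' :: real
          using that by auto
        from this[of "q \<omega> t" "q \<omega>' t"] show ?thesis using a False by auto
      qed
    qed
    finally show ?thesis .
  qed
  have EN: "measure_pmf.expectation M N = \<mu>"
    unfolding N_def \<mu>_def by (simp add: int E1)
  have NN: "(N X)\<^sup>2 = (\<Sum>\<omega>\<in>\<Omega>. \<Sum>\<omega>'\<in>\<Omega>. c \<omega> * c \<omega>' * indicat_real (I \<omega> \<inter> I \<omega>') X)" for X
    unfolding N_def power2_eq_square sum_product by (intro sum.cong) (auto simp: indicator_def)
  have "measure_pmf.expectation M (\<lambda>X. (N X)\<^sup>2) = (\<Sum>\<omega>\<in>\<Omega>. \<Sum>\<omega>'\<in>\<Omega>. c \<omega> * c \<omega>' * measure_pmf.prob M (I \<omega> \<inter> I \<omega>'))"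
    unfolding NN by (simp add: int)
  also have "\<dots> \<le> (\<Sum>\<omega>\<in>\<Omega>. \<Sum>\<omega>'\<in>\<Omega>. \<Prod>t<L. of_bool (e \<omega> t = e \<omega>' t) * q \<omega> t + q \<omega> t * q \<omega>' t)"
    by (intro sum_mono) (use E2 in \<open>simp add: add.commute\<close>)
  also have "\<dots> = (\<Sum>\<omega>\<in>\<Omega>. \<Sum>\<omega>'\<in>\<Omega>. \<Sum>T\<in>Pow {..<L}.
          \<Prod>t<L. if t \<in> T then of_bool (e \<omega> t = e \<omega>' t) * q \<omega> t else q \<omega> t * q \<omega>' t)"
  proof (intro sum.cong refl)
    fix \<omega> \<omega>'
    show "(\<Prod>t<L. of_bool (e \<omega> t = e \<omega>' t) * q \<omega> t + q \<omega> t * q \<omega>' t) = (\<Sum>T\<in>Pow {..<L}.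
          \<Prod>t<L. if t \<in> T then of_bool (e \<omega> t = e \<omega>' t) * q \<omega> t else q \<omega> t * q \<omega>' t)"
      unfolding prod_add[OF finite_lessThan]
      by (intro sum.cong refl) (auto simp: prod.If_cases Int_absorb1 Diff_eq)
  qed
  also have "\<dots> = (\<Sum>T\<in>Pow {..<L}. \<Sum>\<omega>\<in>\<Omega>. \<Sum>\<omega>'\<in>\<Omega>.
          \<Prod>t<L. if t \<in> T then of_bool (e \<omega> t = e \<omega>' t) * q \<omega> t else q \<omega> t * q \<omega>' t)" (is "_ = sum ?f _")
    by (subst sum.swap[of _ "Pow {..<L}"], subst sum.swap[of _ "Pow {..<L}"]) simp
  also have "\<dots> = ?f {} + sum ?f (Pow {..<L} - {{}})"
    by (rule sum.remove) auto
  \<comment> \<open>The term without shared steps is the squared mean, so the remaining terms bound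
    the variance.\<close>
  also have "?f {} = \<mu>\<^sup>2"
    unfolding \<mu>_def power2_eq_square sum_product by (simp add: prod.distrib)
  finally have second: "measure_pmf.expectation M (\<lambda>X. (N X)\<^sup>2) \<le> \<mu>\<^sup>2 + sum ?f (Pow {..<L} - {{}})" .
  have iN: "integrable (measure_pmf M) N" unfolding N_def using int by simp
  have iN2: "integrable (measure_pmf M) (\<lambda>X. (N X)\<^sup>2)" unfolding NN using int by simp
  have V: "measure_pmf.variance M N = measure_pmf.expectation M (\<lambda>X. (N X)\<^sup>2) - \<mu>\<^sup>2"
    by (subst measure_pmf.variance_eq) (use iN iN2 EN in auto)
  \<comment> \<open>If every walk misses an edge, then \<open>N\<close> is 0 and deviates from its
    mean by \<open>\<mu>\<close>; this is the event for Chebyshev.\<close>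
  have "measure_pmf.prob M {X. \<forall>\<omega>\<in>\<Omega>. \<exists>t<L. \<not> X (e \<omega> t)} \<le> measure_pmf.prob M {X \<in> space (measure_pmf M). \<mu> \<le> \<bar>N X - measure_pmf.expectation M N\<bar>}"
  proof (rule measure_pmf.finite_measure_mono)
    have "N X = 0" if "\<forall>\<omega>\<in>\<Omega>. \<exists>t<L. \<not> X (e \<omega> t)" for X
      unfolding N_def using that by (intro sum.neutral) (auto simp: I_def indicator_def)
    then show "{X. \<forall>\<omega>\<in>\<Omega>. \<exists>t<L. \<not> X (e \<omega> t)} \<subseteq> {X \<in> space (measure_pmf M). \<mu> \<le> \<bar>N X - measure_pmf.expectation M N\<bar>}"
      using EN by auto
  qed auto
  also have "\<dots> \<le> measure_pmf.variance M N / \<mu>\<^sup>2"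
    by (rule measure_pmf.Chebyshev_inequality) (use iN2 pos in \<open>auto simp: \<mu>_def\<close>)
  also have "\<dots> \<le> sum ?f (Pow {..<L} - {{}}) / \<mu>\<^sup>2"
    using second V by (intro divide_right_mono) auto
  finally show ?thesis unfolding M_def \<mu>_def .
qed

section \<open>Walks with independent coordinates\<close>

definition walk_weight :: "('s \<Rightarrow> 's \<Rightarrow> real) \<Rightarrow> nat \<Rightarrow> (nat \<Rightarrow> 's) \<Rightarrow> real" where
  "walk_weight Q L z = (\<Prod>t<L. Q (z t) (z (Suc t)))"

definition walk_total :: "('s \<Rightarrow> 's \<Rightarrow> real) \<Rightarrow> nat \<Rightarrow> (nat \<Rightarrow> 's) set \<Rightarrow> real" where
  "walk_total Q L Z = (\<Sum>z\<in>Z. walk_weight Q L z)"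

text \<open>The contribution of two walks to the second moment that is charged to the set \<open>T\<close> of shared
  steps: a shared step is a single coin and is counted once.\<close>

definition pair_weight :: "('s \<Rightarrow> 's \<Rightarrow> real) \<Rightarrow> nat \<Rightarrow> nat set \<Rightarrow> (nat \<Rightarrow> 's) \<Rightarrow> (nat \<Rightarrow> 's) \<Rightarrow> real" where
  "pair_weight Q L T z z' = (\<Prod>t<L. if t \<in> T
     then of_bool (z t = z' t \<and> z (Suc t) = z' (Suc t)) * Q (z t) (z (Suc t))
     else Q (z t) (z (Suc t)) * Q (z' t) (z' (Suc t)))"

definition pair_total :: "('s \<Rightarrow> 's \<Rightarrow> real) \<Rightarrow> nat \<Rightarrow> nat set \<Rightarrow> (nat \<Rightarrow> 's) set \<Rightarrow> real" where
  "pair_total Q L T Z = (\<Sum>z\<in>Z. \<Sum>z'\<in>Z. pair_weight Q L T z z')"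

text \<open>Walks are stored by coordinates: \<open>\<omega> i\<close> is the binary walk of
  coordinate \<open>i\<close>, so a family of walks is a \<open>PiE\<close> and sums over it
  factorise. \<open>layer\<close> recovers the vertex at time \<open>t\<close>, made extensional
  like the elements of \<open>kron_verts\<close>.\<close>

definition layer :: "nat \<Rightarrow> (nat \<Rightarrow> nat \<Rightarrow> nat) \<Rightarrow> nat \<Rightarrow> nat \<Rightarrow> nat" where
  "layer n \<omega> t = (\<lambda>i\<in>{1..n}. \<omega> i t)"

definition kron_coins :: "nat \<Rightarrow> (nat \<Rightarrow> nat \<Rightarrow> real) \<Rightarrow> ((nat \<Rightarrow> nat) set \<Rightarrow> bool) pmf" where
  "kron_coins n P = Pi_pmf (kron_pairs n) False (\<lambda>e. bernoulli_pmf (kron_prob n P e))"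

text \<open>Kept as a relation, so that \<open>kron_arcs n X ^^ k\<close> expresses walks with
  exactly \<open>k\<close> steps.\<close>

definition kron_arcs :: "nat \<Rightarrow> ((nat \<Rightarrow> nat) set \<Rightarrow> bool) \<Rightarrow> ((nat \<Rightarrow> nat) \<times> (nat \<Rightarrow> nat)) set" where
  "kron_arcs n X = {(u, v). u \<in> kron_verts n \<and> v \<in> kron_verts n \<and> u \<noteq> v \<and> X {u, v}}"

section \<open>Factorisation of both moments over the coordinates\<close>

lemma sum_PiE_pairs:
  fixes f :: "'a \<Rightarrow> 'b \<Rightarrow> 'b \<Rightarrow> real"
  assumes "finite A" "\<And>i. i \<in> A \<Longrightarrow> finite (Z i)"
  shows "(\<Sum>\<omega>\<in>PiE A Z. \<Sum>\<omega>'\<in>PiE A Z. \<Prod>i\<in>A. f i (\<omega> i) (\<omega>' i)) = (\<Prod>i\<in>A. \<Sum>z\<in>Z i. \<Sum>z'\<in>Z i. f i z z')"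
proof -
  have "(\<Sum>\<omega>'\<in>PiE A Z. \<Prod>i\<in>A. f i (\<omega> i) (\<omega>' i)) = (\<Prod>i\<in>A. \<Sum>z'\<in>Z i. f i (\<omega> i) z')" for \<omega>
    by (rule prod_sum_PiE[symmetric, OF assms])
  moreover have "(\<Sum>\<omega>\<in>PiE A Z. \<Prod>i\<in>A. \<Sum>z'\<in>Z i. f i (\<omega> i) z') = (\<Prod>i\<in>A. \<Sum>z\<in>Z i. \<Sum>z'\<in>Z i. f i z z')"
    by (rule prod_sum_PiE[symmetric, OF assms])
  ultimately show ?thesis by simp
qed

lemma pair_total_nonneg:
  assumes "\<And>z t. z \<in> Z \<Longrightarrow> t < L \<Longrightarrow> 0 \<le> Q (z t) (z (Suc t))"
  shows "0 \<le> pair_total Q L T Z"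
  unfolding pair_total_def pair_weight_def using assms
  by (auto intro!: sum_nonneg prod_nonneg)

lemma kron_prob_bounds:
  assumes sym: "\<And>i j. P i j = P j i"
    and P: "\<And>i j. i \<in> {0, 1} \<Longrightarrow> j \<in> {0, 1} \<Longrightarrow> 0 \<le> P i j \<and> P i j \<le> 1"
    and e: "e \<in> kron_pairs n"
  shows "0 \<le> kron_prob n P e \<and> kron_prob n P e \<le> 1"
proof -
  obtain u v where uv: "e = {u, v}" "u \<in> kron_verts n" "v \<in> kron_verts n"
    using e by (auto simp: kron_pairs_def)
  have "u i \<in> {0, 1}" "v i \<in> {0, 1}" if "i \<in> {1..n}" for i
    using uv that unfolding kron_verts_def by blast+
  then show ?thesis
    unfolding uv kron_prob_doubleton[of P, OF sym] using P
    by (auto intro!: prod_nonneg prod_le_1)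
qed

lemma kron_pairsI: "u \<in> kron_verts n \<Longrightarrow> v \<in> kron_verts n \<Longrightarrow> u \<noteq> v \<Longrightarrow> {u, v} \<in> kron_pairs n"
  by (auto simp: kron_pairs_def)

lemma layer_in_kron_verts:
  assumes "\<omega> \<in> PiE {1..n} Z" "\<And>i z. i \<in> {1..n} \<Longrightarrow> z \<in> Z i \<Longrightarrow> z t \<in> {0, 1}"
  shows "layer n \<omega> t \<in> kron_verts n"
proof -
  have "\<omega> i t \<in> {0, 1}" if "i \<in> {1..n}" for i
    using assms(2)[OF that PiE_mem[OF assms(1) that]] .
  then show ?thesis unfolding layer_def kron_verts_def by auto
qed

text \<open>An edge probability is a product over the coordinates, and two edges coincide only if
  all coordinates agree, so the bound of \<open>second_moment_walks\<close> factorises. By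
  \<open>dist\<close>, no vertex occurs at two different times, even in different walks of the
  family.\<close>

lemma prob_no_product_walk:
  assumes sym: "\<And>i j. P i j = P j i"
    and P: "\<And>i j. i \<in> {0, 1} \<Longrightarrow> j \<in> {0, 1} \<Longrightarrow> 0 \<le> Q i j \<and> Q i j \<le> P i j \<and> P i j \<le> 1"
    and fin: "\<And>i. i \<in> {1..n} \<Longrightarrow> finite (Z i)"
    and bin: "\<And>i z t. i \<in> {1..n} \<Longrightarrow> z \<in> Z i \<Longrightarrow> z t \<in> {0, 1}"
    and dist: "\<And>\<omega> \<omega>' t t'. \<lbrakk>\<omega> \<in> PiE {1..n} Z; \<omega>' \<in> PiE {1..n} Z; t \<le> L; t' \<le> L; t \<noteq> t'\<rbrakk>
        \<Longrightarrow> layer n \<omega> t \<noteq> layer n \<omega>' t'"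
    and pos: "\<And>i. i \<in> {1..n} \<Longrightarrow> walk_total Q L (Z i) > 0"
  shows "measure_pmf.prob (kron_coins n P)
      {X. \<forall>\<omega>\<in>PiE {1..n} Z. \<exists>t<L. \<not> X {layer n \<omega> t, layer n \<omega> (Suc t)}}
    \<le> (\<Sum>T\<in>Pow {..<L} - {{}}. \<Prod>i\<in>{1..n}. pair_total Q L T (Z i) / (walk_total Q L (Z i))\<^sup>2)"
proof -
  let ?\<Omega> = "PiE {1..n} Z"
  define e where "e = (\<lambda>\<omega> t. {layer n \<omega> t, layer n \<omega> (Suc t)})"
  define q where "q = (\<lambda>\<omega> t. \<Prod>i\<in>{1..n}. Q (\<omega> i t) (\<omega> i (Suc t)))"
  have finO: "finite ?\<Omega>" using fin by (intro finite_PiE) auto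
  have b: "\<omega> i t \<in> {0, 1}" if "\<omega> \<in> ?\<Omega>" "i \<in> {1..n}" for \<omega> i t
    using bin[OF that(2) PiE_mem[OF that]] .
  have verts: "layer n \<omega> t \<in> kron_verts n" if "\<omega> \<in> ?\<Omega>" for \<omega> t
    using layer_in_kron_verts[OF that] bin by blast
  have eE: "e \<omega> t \<in> kron_pairs n" if "\<omega> \<in> ?\<Omega>" "t < L" for \<omega> t
    unfolding e_def by (rule kron_pairsI) (use verts[OF that(1)] dist[OF that(1,1), of t "Suc t"] that(2) in simp_all)
  \<comment> \<open>Edges are unordered, so a common edge could be traversed in opposite directions;
    by \<open>dist\<close> this would need both \<open>t = Suc t'\<close> and
    \<open>t' = Suc t\<close>.\<close>
  have same: "t = t' \<and> layer n \<omega> t = layer n \<omega>' t' \<and> layer n \<omega> (Suc t) = layer n \<omega>' (Suc t')"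
    if "\<omega> \<in> ?\<Omega>" "\<omega>' \<in> ?\<Omega>" "t < L" "t' < L" "e \<omega> t = e \<omega>' t'" for \<omega> \<omega>' t t'
  proof -
    have d: "s = s'" if "layer n \<omega> s = layer n \<omega>' s'" "s \<le> L" "s' \<le> L" for s s'
      using dist[OF \<open>\<omega> \<in> ?\<Omega>\<close> \<open>\<omega>' \<in> ?\<Omega>\<close>, of s s'] that by blast
    from that(5) consider "layer n \<omega> t = layer n \<omega>' t'" "layer n \<omega> (Suc t) = layer n \<omega>' (Suc t')"
      | "layer n \<omega> t = layer n \<omega>' (Suc t')" "layer n \<omega> (Suc t) = layer n \<omega>' t'"
      unfolding e_def doubleton_eq_iff by blast
    then show ?thesis
    proof cases
      case 1
      then show ?thesis using d[of t t'] that(3,4) by simp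
    next
      case 2
      then have "t = Suc t'" "Suc t = t'" using d[of t "Suc t'"] d[of "Suc t" t'] that(3,4) by auto
      then show ?thesis by simp
    qed
  qed
  have tot: "(\<Sum>\<omega>\<in>?\<Omega>. \<Prod>t<L. q \<omega> t) = (\<Prod>i\<in>{1..n}. walk_total Q L (Z i))"
    unfolding q_def walk_total_def walk_weight_def
    by (subst prod_sum_PiE) (auto simp: fin intro!: sum.cong prod.swap)
  have prob: "measure_pmf.prob (kron_coins n P) {X. \<forall>\<omega>\<in>?\<Omega>. \<exists>t<L. \<not> X (e \<omega> t)}
    \<le> (\<Sum>T\<in>Pow {..<L} - {{}}. \<Sum>\<omega>\<in>?\<Omega>. \<Sum>\<omega>'\<in>?\<Omega>.
          \<Prod>t<L. if t \<in> T then of_bool (e \<omega> t = e \<omega>' t) * q \<omega> t else q \<omega> t * q \<omega>' t)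
       / (\<Sum>\<omega>\<in>?\<Omega>. \<Prod>t<L. q \<omega> t)\<^sup>2"
    unfolding kron_coins_def
  proof (rule second_moment_walks)
    fix \<omega> t assume w: "\<omega> \<in> ?\<Omega>" "t < L"
    have "kron_prob n P (e \<omega> t) = (\<Prod>i\<in>{1..n}. P (\<omega> i t) (\<omega> i (Suc t)))"
      unfolding e_def kron_prob_doubleton[of P, OF sym] by (auto simp: layer_def intro!: prod.cong)
    then show "0 \<le> q \<omega> t \<and> q \<omega> t \<le> kron_prob n P (e \<omega> t)"
      using P b[OF w(1)] unfolding q_def by (auto intro!: prod_nonneg prod_mono)
  next
    show "(\<Sum>\<omega>\<in>?\<Omega>. \<Prod>t<L. q \<omega> t) > 0" unfolding tot by (intro prod_pos ballI pos)
  next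
    fix x assume x: "x \<in> kron_pairs n"
    show "0 \<le> kron_prob n P x \<and> kron_prob n P x \<le> 1"
      by (rule kron_prob_bounds[OF sym _ x]) (meson P order_trans)
  next
    show "e \<omega> t \<noteq> e \<omega>' t'" if "\<omega> \<in> ?\<Omega>" "\<omega>' \<in> ?\<Omega>" "t < L" "t' < L" "t \<noteq> t'" for \<omega> \<omega>' t t'
      using same[OF that(1-4)] that(5) by blast
  qed (rule finite_kron_pairs finO eE; assumption)+
  \<comment> \<open>The indicator of a common edge is at most the product of the coordinate
    indicators; exchanging the products over \<open>t\<close> and \<open>i\<close> leaves one
    \<open>pair_weight\<close> per coordinate.\<close>
  have bnd: "(\<Sum>\<omega>\<in>?\<Omega>. \<Sum>\<omega>'\<in>?\<Omega>.
          \<Prod>t<L. if t \<in> T then of_bool (e \<omega> t = e \<omega>' t) * q \<omega> t else q \<omega> t * q \<omega>' t)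
      \<le> (\<Prod>i\<in>{1..n}. pair_total Q L T (Z i))" for T
  proof -
    have "(\<Sum>\<omega>\<in>?\<Omega>. \<Sum>\<omega>'\<in>?\<Omega>.
          \<Prod>t<L. if t \<in> T then of_bool (e \<omega> t = e \<omega>' t) * q \<omega> t else q \<omega> t * q \<omega>' t)
      \<le> (\<Sum>\<omega>\<in>?\<Omega>. \<Sum>\<omega>'\<in>?\<Omega>. \<Prod>i\<in>{1..n}. pair_weight Q L T (\<omega> i) (\<omega>' i))"
    proof (intro sum_mono)
      fix \<omega> \<omega>' assume w: "\<omega> \<in> ?\<Omega>" "\<omega>' \<in> ?\<Omega>"
      have q0: "0 \<le> q \<omega> t" "0 \<le> q \<omega>' t" for t
        unfolding q_def using P b w by (auto intro!: prod_nonneg)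
      have "(\<Prod>t<L. if t \<in> T then of_bool (e \<omega> t = e \<omega>' t) * q \<omega> t else q \<omega> t * q \<omega>' t)
        \<le> (\<Prod>t<L. \<Prod>i\<in>{1..n}. if t \<in> T
     then of_bool (\<omega> i t = \<omega>' i t \<and> \<omega> i (Suc t) = \<omega>' i (Suc t)) * Q (\<omega> i t) (\<omega> i (Suc t))
     else Q (\<omega> i t) (\<omega> i (Suc t)) * Q (\<omega>' i t) (\<omega>' i (Suc t)))"
      proof (rule prod_mono, rule conjI)
        fix t assume t: "t \<in> {..<L}"
        show "0 \<le> (if t \<in> T then of_bool (e \<omega> t = e \<omega>' t) * q \<omega> t else q \<omega> t * q \<omega>' t)"
          using q0 by simp
        show "(if t \<in> T then of_bool (e \<omega> t = e \<omega>' t) * q \<omega> t else q \<omega> t * q \<omega>' t)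
          \<le> (\<Prod>i\<in>{1..n}. if t \<in> T
     then of_bool (\<omega> i t = \<omega>' i t \<and> \<omega> i (Suc t) = \<omega>' i (Suc t)) * Q (\<omega> i t) (\<omega> i (Suc t))
     else Q (\<omega> i t) (\<omega> i (Suc t)) * Q (\<omega>' i t) (\<omega>' i (Suc t)))" (is "_ \<le> ?R")
        proof (cases "t \<in> T \<and> e \<omega> t \<noteq> e \<omega>' t")
          case True
          then show ?thesis using P b w by (auto intro!: prod_nonneg)
        next
          case False
          have "layer n \<omega> t = layer n \<omega>' t \<and> layer n \<omega> (Suc t) = layer n \<omega>' (Suc t)" if "t \<in> T"
            using same[OF w, of t t] False that t by blast
          then have "\<omega> i t = \<omega>' i t \<and> \<omega> i (Suc t) = \<omega>' i (Suc t)" if "t \<in> T" "i \<in> {1..n}" for i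
            using that unfolding layer_def by (metis restrict_apply')
          then show ?thesis using False by (auto simp: q_def prod.distrib)
        qed
      qed
      also have "\<dots> = (\<Prod>i\<in>{1..n}. pair_weight Q L T (\<omega> i) (\<omega>' i))"
        unfolding pair_weight_def by (rule prod.swap)
      finally show "(\<Prod>t<L. if t \<in> T then of_bool (e \<omega> t = e \<omega>' t) * q \<omega> t else q \<omega> t * q \<omega>' t)
        \<le> (\<Prod>i\<in>{1..n}. pair_weight Q L T (\<omega> i) (\<omega>' i))" .
    qed
    also have "\<dots> = (\<Prod>i\<in>{1..n}. pair_total Q L T (Z i))"
      unfolding pair_total_def by (rule sum_PiE_pairs) (use fin in auto)
    finally show ?thesis .
  qed
  note prob
  also have "(\<Sum>T\<in>Pow {..<L} - {{}}. \<Sum>\<omega>\<in>?\<Omega>. \<Sum>\<omega>'\<in>?\<Omega>.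
          \<Prod>t<L. if t \<in> T then of_bool (e \<omega> t = e \<omega>' t) * q \<omega> t else q \<omega> t * q \<omega>' t)
       / (\<Sum>\<omega>\<in>?\<Omega>. \<Prod>t<L. q \<omega> t)\<^sup>2
     \<le> (\<Sum>T\<in>Pow {..<L} - {{}}. \<Prod>i\<in>{1..n}. pair_total Q L T (Z i))
       / (\<Sum>\<omega>\<in>?\<Omega>. \<Prod>t<L. q \<omega> t)\<^sup>2"
    by (intro divide_right_mono sum_mono bnd) simp
  also have "\<dots> = (\<Sum>T\<in>Pow {..<L} - {{}}. \<Prod>i\<in>{1..n}. pair_total Q L T (Z i) / (walk_total Q L (Z i))\<^sup>2)"
    unfolding tot by (simp add: sum_divide_distrib prod_dividef prod_power_distrib)
  finally show ?thesis unfolding e_def .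
qed

text \<open>Every edge of a walk contains an interior vertex because \<open>2 \<le> L\<close>, and
  by \<open>dist\<close> interior vertices for different elements of \<open>J\<close> are distinct.
  So the families indexed by \<open>J\<close> use disjoint sets of coins, and their failure
  probabilities multiply.\<close>

lemma prob_no_relpow:
  fixes Z :: "'j \<Rightarrow> nat \<Rightarrow> (nat \<Rightarrow> nat) set"
  assumes sym: "\<And>i j. P i j = P j i"
    and P: "\<And>i j. i \<in> {0, 1} \<Longrightarrow> j \<in> {0, 1} \<Longrightarrow> 0 \<le> Q i j \<and> Q i j \<le> P i j \<and> P i j \<le> 1"
    and J: "finite J" "J \<noteq> {}" and L: "2 \<le> L"
    and fin: "\<And>a i. a \<in> J \<Longrightarrow> i \<in> {1..n} \<Longrightarrow> finite (Z a i)"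
    and bin: "\<And>a i z t. a \<in> J \<Longrightarrow> i \<in> {1..n} \<Longrightarrow> z \<in> Z a i \<Longrightarrow> z t \<in> {0, 1}"
    and start: "\<And>a \<omega>. a \<in> J \<Longrightarrow> \<omega> \<in> PiE {1..n} (Z a) \<Longrightarrow> layer n \<omega> 0 = u \<and> layer n \<omega> L = v"
    and uv: "u \<noteq> v"
    and dist: "\<And>a a' \<omega> \<omega>' t t'. \<lbrakk>a \<in> J; a' \<in> J; \<omega> \<in> PiE {1..n} (Z a); \<omega>' \<in> PiE {1..n} (Z a');
         0 < t; t < L; t' \<le> L; (a, t) \<noteq> (a', t')\<rbrakk>
        \<Longrightarrow> layer n \<omega> t \<noteq> layer n \<omega>' t'"
    and pos: "\<And>a i. a \<in> J \<Longrightarrow> i \<in> {1..n} \<Longrightarrow> walk_total Q L (Z a i) > 0"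
  shows "measure_pmf.prob (kron_coins n P) {X. (u, v) \<notin> kron_arcs n X ^^ L}
    \<le> (\<Prod>a\<in>J. \<Sum>T\<in>Pow {..<L} - {{}}. \<Prod>i\<in>{1..n}. pair_total Q L T (Z a i) / (walk_total Q L (Z a i))\<^sup>2)"
proof -
  define e where "e = (\<lambda>\<omega> t. {layer n \<omega> t, layer n \<omega> (Suc t)})"
  define A where "A = (\<lambda>a. {X. \<forall>\<omega>\<in>PiE {1..n} (Z a). \<exists>t<L. \<not> X (e \<omega> t)})"
  define D where "D = (\<lambda>a. {e \<omega> t | \<omega> t. \<omega> \<in> PiE {1..n} (Z a) \<and> t < L})"
  have verts: "layer n \<omega> t \<in> kron_verts n" if "a \<in> J" "\<omega> \<in> PiE {1..n} (Z a)" for \<omega> t a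
    using layer_in_kron_verts[OF that(2)] bin[OF that(1)] by blast
  \<comment> \<open>\<open>dist\<close> asks for one interior time; when the two times are 0 and
    \<open>L\<close>, the vertices differ because \<open>u \<noteq> v\<close>.\<close>
  have dist1: "layer n \<omega> t \<noteq> layer n \<omega>' t'"
    if h: "a \<in> J" "\<omega> \<in> PiE {1..n} (Z a)" "\<omega>' \<in> PiE {1..n} (Z a)" "t \<le> L" "t' \<le> L" "t \<noteq> t'" for a \<omega> \<omega>' t t'
  proof -
    consider "0 < t" "t < L" | "0 < t'" "t' < L" | "t = 0" "t' = L" | "t = L" "t' = 0"
      using h by fastforce
    then show ?thesis
    proof cases
      case 1
      then show ?thesis using dist[OF h(1,1,2,3)] h by auto
    next
      case 2
      then show ?thesis using dist[OF h(1,1,3,2), of t' t] h by (metis prod.inject)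
    qed (use start[OF h(1,2)] start[OF h(1,3)] uv in auto)
  qed
  have DE: "D a \<subseteq> kron_pairs n" if "a \<in> J" for a
  proof
    fix x assume "x \<in> D a"
    then obtain \<omega> t where x: "x = e \<omega> t" "\<omega> \<in> PiE {1..n} (Z a)" "t < L" by (auto simp: D_def)
    then show "x \<in> kron_pairs n"
      unfolding x(1) e_def
      by (intro kron_pairsI verts[OF that x(2)] dist1[OF that x(2,2)]) (use x(3) in simp_all)
  qed
  have disj: "disjoint_family_on D J"
    unfolding disjoint_family_on_def
  proof (intro ballI impI, rule ccontr)
    fix a a' assume a: "a \<in> J" "a' \<in> J" "a \<noteq> a'" "D a \<inter> D a' \<noteq> {}"
    then obtain \<omega> \<omega>' t t' where w: "\<omega> \<in> PiE {1..n} (Z a)" "\<omega>' \<in> PiE {1..n} (Z a')" "t < L" "t' < L" "e \<omega> t = e \<omega>' t'"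
      unfolding D_def by blast
    \<comment> \<open>\<open>s\<close> is an interior end of the edge: time 0 is replaced by 1,
      which is less than \<open>L\<close>.\<close>
    define s where "s = (if t = 0 then 1 else t)"
    have s: "0 < s" "s < L" "s = t \<or> s = Suc t" using L w(3) by (auto simp: s_def)
    then have "layer n \<omega> s \<in> e \<omega>' t'" using w(5) unfolding e_def by blast
    then show False
      using dist[OF a(1,2) w(1,2) s(1,2), of t'] dist[OF a(1,2) w(1,2) s(1,2), of "Suc t'"] a(3) w(4)
      unfolding e_def by auto
  qed
  have "{X. (u, v) \<notin> kron_arcs n X ^^ L} \<subseteq> (\<Inter>a\<in>J. A a)"
  proof (safe, rule ccontr)
    fix X a assume X: "(u, v) \<notin> kron_arcs n X ^^ L" and a: "a \<in> J" "X \<notin> A a"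
    then obtain \<omega> where w: "\<omega> \<in> PiE {1..n} (Z a)" "\<forall>t<L. X (e \<omega> t)" by (auto simp: A_def)
    have "(layer n \<omega> t, layer n \<omega> (Suc t)) \<in> kron_arcs n X" if "t < L" for t
      using verts[OF a(1) w(1)] dist1[OF a(1) w(1) w(1), of t "Suc t"] that w(2) by (auto simp: kron_arcs_def e_def)
    then have "(u, v) \<in> kron_arcs n X ^^ L"
      unfolding relpow_fun_conv using start[OF a(1) w(1)] by blast
    then show False using X by blast
  qed
  then have "measure_pmf.prob (kron_coins n P) {X. (u, v) \<notin> kron_arcs n X ^^ L}
      \<le> measure_pmf.prob (kron_coins n P) (\<Inter>a\<in>J. A a)"
    by (intro measure_pmf.finite_measure_mono) auto
  also have "\<dots> = (\<Prod>a\<in>J. measure_pmf.prob (kron_coins n P) (A a))"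
    unfolding kron_coins_def
  proof (rule Pi_pmf_prob_Int_indep[OF finite_kron_pairs J DE disj])
    fix a X Y assume h: "a \<in> J" "X \<in> A a" "\<forall>x\<in>D a. X x = Y x"
    have "X (e \<omega> t) = Y (e \<omega> t)" if "\<omega> \<in> PiE {1..n} (Z a)" "t < L" for \<omega> t
      using h(3) that by (auto simp: D_def)
    then show "Y \<in> A a" using h(2) unfolding A_def mem_Collect_eq by metis
  qed
  also have "\<dots> \<le> (\<Prod>a\<in>J. \<Sum>T\<in>Pow {..<L} - {{}}. \<Prod>i\<in>{1..n}. pair_total Q L T (Z a i) / (walk_total Q L (Z a i))\<^sup>2)"
  proof (rule prod_mono, rule conjI)
    fix a assume a: "a \<in> J"
    show "measure_pmf.prob (kron_coins n P) (A a)
      \<le> (\<Sum>T\<in>Pow {..<L} - {{}}. \<Prod>i\<in>{1..n}. pair_total Q L T (Z a i) / (walk_total Q L (Z a i))\<^sup>2)"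
      unfolding A_def e_def
    proof (rule prob_no_product_walk)
      show "P i j = P j i" for i j by (rule sym)
      show "0 \<le> Q i j \<and> Q i j \<le> P i j \<and> P i j \<le> 1" if "i \<in> {0, 1}" "j \<in> {0, 1}" for i j
        by (rule P[OF that])
      show "finite (Z a i)" if "i \<in> {1..n}" for i by (rule fin[OF a that])
      show "z t \<in> {0, 1}" if "i \<in> {1..n}" "z \<in> Z a i" for i z t by (rule bin[OF a that])
      show "walk_total Q L (Z a i) > 0" if "i \<in> {1..n}" for i by (rule pos[OF a that])
    qed (rule dist1[OF a])
  qed simp
  finally show ?thesis .
qed

section \<open>Independent attempts to reach the hub\<close>

definition kron_hub :: "nat \<Rightarrow> nat \<Rightarrow> nat" where
  "kron_hub n = (\<lambda>i\<in>{1..n}. 1)"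

text \<open>For coordinates with a prescribed walk. The pair weight is at most the walk weight
  \<open>w\<close>, so the ratio is at most \<open>1 / w\<close>. It may exceed 1, which is harmless
  for a bounded number of coordinates.\<close>

lemma singleton_walk_totals:
  assumes Q: "\<And>t. t < L \<Longrightarrow> m \<le> Q (z t) (z (Suc t)) \<and> Q (z t) (z (Suc t)) \<le> 1" and m: "0 < m"
  shows "walk_total Q L {z} > 0"
    and "pair_total Q L T {z} / (walk_total Q L {z})\<^sup>2 \<le> (1 / m) ^ L"
proof -
  define w where "w = (\<Prod>t<L. Q (z t) (z (Suc t)))"
  have wt: "walk_total Q L {z} = w" by (simp add: walk_total_def walk_weight_def w_def)
  have "(\<Prod>t<L. m) \<le> w" unfolding w_def using Q m by (intro prod_mono) auto
  then have w: "m ^ L \<le> w" by simp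
  moreover have "0 < m ^ L" using m by simp
  ultimately have w0: "0 < w" by linarith
  then show "walk_total Q L {z} > 0" using wt by simp
  have "pair_total Q L T {z}
      = (\<Prod>t<L. if t \<in> T then Q (z t) (z (Suc t)) else Q (z t) (z (Suc t)) * Q (z t) (z (Suc t)))"
    unfolding pair_total_def pair_weight_def by (simp cong: if_cong)
  also have "\<dots> \<le> w"
    unfolding w_def
  proof (rule prod_mono)
    fix t assume "t \<in> {..<L}"
    then have q: "0 \<le> Q (z t) (z (Suc t))" "Q (z t) (z (Suc t)) \<le> 1" using Q[of t] m by auto
    then show "0 \<le> (if t \<in> T then Q (z t) (z (Suc t)) else Q (z t) (z (Suc t)) * Q (z t) (z (Suc t)))
      \<and> (if t \<in> T then Q (z t) (z (Suc t)) else Q (z t) (z (Suc t)) * Q (z t) (z (Suc t))) \<le> Q (z t) (z (Suc t))"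
      by (auto intro: mult_left_le)
  qed
  finally have "pair_total Q L T {z} \<le> w" .
  then have "pair_total Q L T {z} / w\<^sup>2 \<le> w / w\<^sup>2" using w0 by (intro divide_right_mono) auto
  also have "\<dots> = 1 / w" by (simp add: power2_eq_square)
  also have "\<dots> \<le> 1 / m ^ L" using w m by (intro divide_left_mono) (auto simp: w0)
  finally show "pair_total Q L T {z} / (walk_total Q L {z})\<^sup>2 \<le> (1 / m) ^ L"
    by (simp add: wt power_one_over)
qed

text \<open>The label coordinates \<open>I\<close> are indexed by the pairs (attempt, interior time). At an interior time
  of an attempt exactly one of them is zero, namely the one of that pair; so the interior vertices of all
  attempts and times are distinct. They also differ from \<open>u\<close>, which is constant on \<open>I\<close>, since \<open>I\<close> has
  at least two elements.\<close>

lemma prob_not_reaching_hub: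
  fixes Zf :: "nat \<Rightarrow> (nat \<Rightarrow> nat) set"
  assumes sym: "\<And>i j. P i j = P j i"
    and P: "\<And>i j. i \<in> {0, 1} \<Longrightarrow> j \<in> {0, 1} \<Longrightarrow> 0 \<le> Q i j \<and> Q i j \<le> P i j \<and> P i j \<le> 1"
    and L: "2 \<le> L" and k: "0 < k" "2 \<le> k * (L - 1)"
    and fin: "\<And>x. x \<in> {0, 1} \<Longrightarrow> finite (Zf x)"
    and Zf: "\<And>x z. x \<in> {0, 1} \<Longrightarrow> z \<in> Zf x \<Longrightarrow> z 0 = x \<and> z L = 1"
    and bin: "\<And>x z t. x \<in> {0, 1} \<Longrightarrow> z \<in> Zf x \<Longrightarrow> z t \<in> {0, 1}"
    and pos: "\<And>x. x \<in> {0, 1} \<Longrightarrow> walk_total Q L (Zf x) > 0"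
    and ratio: "\<And>x T. x \<in> {0, 1} \<Longrightarrow> T \<subseteq> {..<L} \<Longrightarrow> T \<noteq> {} \<Longrightarrow>
        pair_total Q L T (Zf x) \<le> (walk_total Q L (Zf x))\<^sup>2"
    and ratio_c: "\<And>T. T \<subseteq> {..<L} \<Longrightarrow> T \<noteq> {} \<Longrightarrow>
        pair_total Q L T (Zf c) \<le> \<theta> * (walk_total Q L (Zf c))\<^sup>2"
    and \<theta>: "0 < \<theta>" "\<theta> \<le> 1"
    and c: "c \<in> {0, 1}"
    and m: "0 < m" "m \<le> Q c 1" "m \<le> Q c 0" "m \<le> Q 1 1" "m \<le> Q 1 0" "m \<le> Q 0 1"
    and u: "u \<in> kron_verts n" "u \<noteq> kron_hub n"
    and many: "k * (L - 1) \<le> n div 2" "n div 2 \<le> card {i \<in> {1..n}. u i = c}"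
  shows "measure_pmf.prob (kron_coins n P) {X. (u, kron_hub n) \<notin> kron_arcs n X ^^ L}
    \<le> (2 ^ L * ((1 / m) ^ L) ^ (k * (L - 1)) * \<theta> ^ (n div 2 - k * (L - 1))) ^ k"
proof -
  define lbls where "lbls = {..<k} \<times> {1..<L}"
  have cl: "card lbls = k * (L - 1)" by (simp add: lbls_def)
  have "k * (L - 1) \<le> card {i \<in> {1..n}. u i = c}" using many by (rule order_trans)
  then obtain I where I: "I \<subseteq> {i \<in> {1..n}. u i = c}" "card I = k * (L - 1)" "finite I"
    by (rule obtain_subset_with_card_n)
  have "finite lbls" by (simp add: lbls_def)
  then obtain lab where lab: "bij_betw lab lbls I"
    using finite_same_card_bij[of lbls I] I(2,3) cl by auto
  have labI: "lab l \<in> I" if "l \<in> lbls" for l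
    using lab that by (auto simp: bij_betw_def)
  have inj: "l = l'" if "lab l = lab l'" "l \<in> lbls" "l' \<in> lbls" for l l'
    using lab that by (auto simp: bij_betw_def inj_on_def)
  \<comment> \<open>A label coordinate starts at the value \<open>c\<close> of \<open>u\<close>.
    After time 0 it is 0 only at the interior time that it labels for the index \<open>a\<close>, if
    any, and otherwise 1, as at the hub.\<close>
  define lw where "lw = (\<lambda>a i s. if s = 0 then c else if s < L \<and> lab (a, s) = i then 0 else (1::nat))"
  define Z where "Z = (\<lambda>a i. if i \<in> I then {lw a i} else Zf (u i))"
  have u01: "u i \<in> {0, 1}" if "i \<in> {1..n}" for i
    using u(1) that by (auto simp: kron_verts_def)
  have In: "i \<in> {1..n}" "u i = c" if "i \<in> I" for i using I(1) that by auto
  have val: "layer n \<omega> t i = lw a i t" if "\<omega> \<in> PiE {1..n} (Z a)" "i \<in> I" for \<omega> a i t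
  proof -
    have "\<omega> i = lw a i" using PiE_mem[OF that(1) In(1)[OF that(2)]] that(2) by (simp add: Z_def)
    then show ?thesis using In(1)[OF that(2)] by (simp add: layer_def)
  qed
  have Zbin: "z t \<in> {0, 1}" if "i \<in> {1..n}" "z \<in> Z a i" for a i z t
  proof (cases "i \<in> I")
    case True
    then show ?thesis using that(2) c by (simp add: Z_def lw_def)
  next
    case False
    then show ?thesis using that(2) bin[OF u01[OF that(1)]] by (simp only: Z_def if_False)
  qed
  \<comment> \<open>As \<open>lab\<close> is injective, 0 can follow 0 only in the first step, out
    of \<open>c\<close>; that case is covered by \<open>m \<le> Q c 0\<close>.\<close>
  have lw_step: "m \<le> Q (lw a i t) (lw a i (Suc t)) \<and> Q (lw a i t) (lw a i (Suc t)) \<le> 1"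
    if "a < k" "i \<in> I" "t < L" for a i t
  proof
    have "\<not> (lab (a, t) = i \<and> lab (a, Suc t) = i \<and> 0 < t \<and> Suc t < L)"
      using inj[of "(a, t)" "(a, Suc t)"] that by (auto simp: lbls_def)
    then show "m \<le> Q (lw a i t) (lw a i (Suc t))"
      using m c by (auto simp: lw_def)
    have "lw a i s \<in> {0, 1}" for s using c by (auto simp: lw_def)
    from P[OF this this] show "Q (lw a i t) (lw a i (Suc t)) \<le> 1" by (blast intro: order_trans)
  qed
  have "measure_pmf.prob (kron_coins n P) {X. (u, kron_hub n) \<notin> kron_arcs n X ^^ L}
    \<le> (\<Prod>a\<in>{..<k}. \<Sum>T\<in>Pow {..<L} - {{}}. \<Prod>i\<in>{1..n}. pair_total Q L T (Z a i) / (walk_total Q L (Z a i))\<^sup>2)"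
  proof (rule prob_no_relpow[OF sym P])
    show "layer n \<omega> 0 = u \<and> layer n \<omega> L = kron_hub n" if w: "\<omega> \<in> PiE {1..n} (Z a)" for a \<omega>
    proof -
      have "\<omega> i 0 = u i \<and> \<omega> i L = 1" if "i \<in> {1..n}" for i
      proof (cases "i \<in> I")
        case True
        then have "\<omega> i = lw a i" using PiE_mem[OF w that] by (simp add: Z_def)
        then show ?thesis using In(2)[OF True] L by (simp add: lw_def)
      next
        case False
        then have "\<omega> i \<in> Zf (u i)" using PiE_mem[OF w that] by (simp add: Z_def)
        then show ?thesis by (rule Zf[OF u01[OF that]])
      qed
      moreover have "u i = undefined" if "i \<notin> {1..n}" for i using u(1) that by (auto simp: kron_verts_def)
      ultimately show ?thesis by (auto simp: layer_def kron_hub_def fun_eq_iff)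
    qed
    show "layer n \<omega> t \<noteq> layer n \<omega>' t'"
      if h: "a \<in> {..<k}" "a' \<in> {..<k}" "\<omega> \<in> PiE {1..n} (Z a)" "\<omega>' \<in> PiE {1..n} (Z a')"
         "0 < t" "t < L" "t' \<le> L" "(a, t) \<noteq> (a', t')" for a a' \<omega> \<omega>' t t'
    proof -
      have l: "(a, t) \<in> lbls" using h by (auto simp: lbls_def)
      have zero: "layer n \<omega> t (lab (a, t)) = 0" using val[OF h(3) labI[OF l]] h(5,6) by (simp add: lw_def)
      show ?thesis
      proof (cases "t' = 0 \<and> c = 0")
        case True
        have "lbls - {(a, t)} \<noteq> {}"
        proof
          assume "lbls - {(a, t)} = {}"
          then have "card lbls \<le> card {(a, t)}" by (intro card_mono) auto
          then show False using k(2) cl by simp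
        qed
        then obtain l' where l': "l' \<in> lbls" "l' \<noteq> (a, t)" by blast
        have "layer n \<omega> t (lab l') = 1"
          using val[OF h(3) labI[OF l'(1)], of t] inj[OF _ l l'(1)] l'(2) h(5) by (auto simp: lw_def)
        moreover have "layer n \<omega>' t' (lab l') = 0"
          using val[OF h(4) labI[OF l'(1)], of t'] True by (auto simp: lw_def)
        ultimately show ?thesis by (metis zero_neq_one)
      next
        case False
        have "\<not> (t' \<noteq> 0 \<and> t' < L \<and> lab (a', t') = lab (a, t))"
          using inj[OF _ _ l, of "(a', t')"] h by (auto simp: lbls_def)
        then have "layer n \<omega>' t' (lab (a, t)) = 1"
          using val[OF h(4) labI[OF l], of t'] False c by (auto simp: lw_def)
        then show ?thesis using zero by (metis zero_neq_one)
      qed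
    qed
    show "z t \<in> {0, 1}" if "i \<in> {1..n}" "z \<in> Z a i" for a i z t
      by (rule Zbin[OF that])
    show "finite (Z a i)" if "i \<in> {1..n}" for a i
      using fin[OF u01[OF that]] by (simp add: Z_def)
    show "walk_total Q L (Z a i) > 0" if "a \<in> {..<k}" "i \<in> {1..n}" for a i
    proof (cases "i \<in> I")
      case True
      have "0 < walk_total Q L {lw a i}"
        by (rule singleton_walk_totals(1)[of L m Q, OF _ m(1)], rule lw_step) (use that True in auto)
      then show ?thesis using True by (simp add: Z_def)
    next
      case False
      then show ?thesis using pos[OF u01[OF that(2)]] by (simp add: Z_def)
    qed
  qed (use k(1) L u(2) in auto)
  also have "\<dots> \<le> (\<Prod>a\<in>{..<k}. 2 ^ L * ((1 / m) ^ L) ^ (k * (L - 1)) * \<theta> ^ (n div 2 - k * (L - 1)))"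
  proof (rule prod_mono, rule conjI)
    fix a assume a: "a \<in> {..<k}"
    define r where "r = (\<lambda>T i. pair_total Q L T (Z a i) / (walk_total Q L (Z a i))\<^sup>2)"
    have Q0: "0 \<le> Q (z t) (z (Suc t))" if "i \<in> {1..n}" "z \<in> Z a i" for i z t
      using P[OF Zbin[OF that] Zbin[OF that]] by blast
    have r0: "0 \<le> r T i" if "i \<in> {1..n}" for T i
      unfolding r_def using Q0[OF that] by (intro divide_nonneg_nonneg pair_total_nonneg) auto
    show "0 \<le> (\<Sum>T\<in>Pow {..<L} - {{}}. \<Prod>i\<in>{1..n}. pair_total Q L T (Z a i) / (walk_total Q L (Z a i))\<^sup>2)"
      using r0 unfolding r_def by (intro sum_nonneg prod_nonneg) auto
    \<comment> \<open>Each coordinate in \<open>B\<close> contributes a factor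
      \<open>\<theta>\<close>, a label coordinate at most \<open>(1 / m) ^ L\<close>, and any other
      coordinate at most 1.\<close>
    define B where "B = {i \<in> {1..n}. u i = c} - I"
    have "card B = card {i \<in> {1..n}. u i = c} - card I"
      unfolding B_def using I by (intro card_Diff_subset) auto
    then have cB: "n div 2 - k * (L - 1) \<le> card B" unfolding I(2) using diff_le_mono[OF many(2)] by simp
    have bnd: "(\<Prod>i\<in>{1..n}. r T i) \<le> ((1 / m) ^ L) ^ (k * (L - 1)) * \<theta> ^ (n div 2 - k * (L - 1))"
      if T: "T \<subseteq> {..<L}" "T \<noteq> {}" for T
    proof -
      have le: "(\<Prod>i\<in>{1..n}. r T i) \<le> (\<Prod>i\<in>{1..n}. (if i \<in> I then (1 / m) ^ L else 1) * (if i \<in> B then \<theta> else 1))"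
      proof (rule prod_mono, rule conjI)
        fix i assume i: "i \<in> {1..n}"
        show "0 \<le> r T i" by (rule r0[OF i])
        show "r T i \<le> (if i \<in> I then (1 / m) ^ L else 1) * (if i \<in> B then \<theta> else 1)"
        proof (cases "i \<in> I")
          case True
          have "pair_total Q L T {lw a i} / (walk_total Q L {lw a i})\<^sup>2 \<le> (1 / m) ^ L"
            by (rule singleton_walk_totals(2)[of L m Q, OF _ m(1)], rule lw_step) (use a True in auto)
          then show ?thesis using True by (simp add: r_def Z_def B_def)
        next
          case False
          have "r T i \<le> (if u i = c then \<theta> else 1)"
            unfolding r_def using False pos[OF u01[OF i]] ratio[OF u01[OF i] T] ratio_c[OF T]
            by (auto simp: Z_def pos_divide_le_eq)
          then show ?thesis using False i by (auto simp: B_def)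
        qed
      qed
      have eq: "(\<Prod>i\<in>{1..n}. (if i \<in> I then (1 / m) ^ L else 1) * (if i \<in> B then \<theta> else 1))
          = ((1 / m) ^ L) ^ (k * (L - 1)) * \<theta> ^ card B"
      proof -
        have "I \<subseteq> {1..n}" "B \<subseteq> {1..n}" using In by (auto simp: B_def)
        then show ?thesis by (simp add: prod.distrib prod.If_cases Int_absorb1 I(2))
      qed
      have "\<theta> ^ card B \<le> \<theta> ^ (n div 2 - k * (L - 1))"
        by (rule power_decreasing) (use cB \<theta> in simp_all)
      then have "((1 / m) ^ L) ^ (k * (L - 1)) * \<theta> ^ card B
          \<le> ((1 / m) ^ L) ^ (k * (L - 1)) * \<theta> ^ (n div 2 - k * (L - 1))"
        by (rule mult_left_mono) (use m(1) in simp)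
      then show ?thesis using le unfolding eq by (rule order_trans[rotated])
    qed
    have "(\<Sum>T\<in>Pow {..<L} - {{}}. \<Prod>i\<in>{1..n}. r T i)
      \<le> real (card (Pow {..<L} - {{}})) * (((1 / m) ^ L) ^ (k * (L - 1)) * \<theta> ^ (n div 2 - k * (L - 1)))"
      by (rule sum_bounded_above) (use bnd in blast)
    also have "\<dots> \<le> 2 ^ L * (((1 / m) ^ L) ^ (k * (L - 1)) * \<theta> ^ (n div 2 - k * (L - 1)))"
    proof (rule mult_right_mono)
      have "card (Pow {..<L} - {{}}) \<le> card (Pow {..<L})" by (intro card_mono) auto
      then have "card (Pow {..<L} - {{}}) \<le> 2 ^ L" by (simp add: card_Pow)
      then show "real (card (Pow {..<L} - {{}})) \<le> 2 ^ L"
        by (metis of_nat_le_iff of_nat_numeral of_nat_power)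
    qed (use m \<theta> in auto)
    finally show "(\<Sum>T\<in>Pow {..<L} - {{}}. \<Prod>i\<in>{1..n}. pair_total Q L T (Z a i) / (walk_total Q L (Z a i))\<^sup>2)
      \<le> 2 ^ L * ((1 / m) ^ L) ^ (k * (L - 1)) * \<theta> ^ (n div 2 - k * (L - 1))"
      unfolding r_def by (simp add: mult.assoc)
  qed
  also have "\<dots> = (2 ^ L * ((1 / m) ^ L) ^ (k * (L - 1)) * \<theta> ^ (n div 2 - k * (L - 1))) ^ k" by simp
  finally show ?thesis .
qed

section \<open>Binary walks for a matrix with constant row sums\<close>

text \<open>The walks with \<open>L\<close> steps from \<open>x\<close> to 1. They are continued by
  the constant 1 after time \<open>L\<close>, so that each walk is represented by exactly one
  function.\<close>

fun bin_walks :: "nat \<Rightarrow> nat \<Rightarrow> (nat \<Rightarrow> nat) set" where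
  "bin_walks 0 x = (if x = 1 then {\<lambda>_. 1} else {})"
| "bin_walks (Suc L) x = case_nat x ` (bin_walks L 0 \<union> bin_walks L 1)"

lemma finite_bin_walks: "finite (bin_walks L x)"
  by (induction L arbitrary: x) auto

lemma bin_walks_ends: "z \<in> bin_walks L x \<Longrightarrow> z 0 = x \<and> z L = 1"
  by (induction L arbitrary: x z) (auto split: if_splits)

lemma bin_walks_binary: "z \<in> bin_walks L x \<Longrightarrow> x \<in> {0, 1} \<Longrightarrow> z t \<in> {0, 1}"
proof (induction L arbitrary: x z t)
  case (Suc L)
  then obtain y z' where z: "z = case_nat x z'" "z' \<in> bin_walks L y" "y \<in> {0, 1}" by auto
  show ?case using Suc.IH[OF z(2,3)] Suc.prems(2) by (cases t) (auto simp: z(1))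
qed (auto split: if_splits)

lemma sum_bin_walks_Suc:
  fixes f :: "(nat \<Rightarrow> nat) \<Rightarrow> real"
  shows "(\<Sum>z\<in>bin_walks (Suc L) x. f z) = (\<Sum>y\<in>{0, 1}. \<Sum>z\<in>bin_walks L y. f (case_nat x z))"
proof -
  have inj: "inj_on (case_nat x) A" for A :: "(nat \<Rightarrow> nat) set"
    by (rule inj_onI) (metis ext nat.case(2))
  have disj: "bin_walks L 0 \<inter> bin_walks L 1 = {}"
    using bin_walks_ends[of _ L] by (metis disjoint_iff zero_neq_one)
  show ?thesis
    unfolding bin_walks.simps sum.reindex[OF inj] comp_def
    by (subst sum.union_disjoint) (use disj finite_bin_walks in auto)
qed

lemma walk_total_bin_walks_Suc:
  "walk_total Q (Suc L) (bin_walks (Suc L) x) = (\<Sum>y\<in>{0, 1}. Q x y * walk_total Q L (bin_walks L y))"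
proof -
  have "walk_weight Q (Suc L) (case_nat x z) = Q x (z 0) * walk_weight Q L z" for z
    unfolding walk_weight_def by (simp only: prod.lessThan_Suc_shift) simp
  then show ?thesis
    unfolding walk_total_def sum_bin_walks_Suc sum_distrib_left
    using bin_walks_ends by (intro sum.cong refl) metis
qed

text \<open>Two starting points are carried along because the first steps may lead to different
  states; the case \<open>x = x'\<close> is \<open>pair_total\<close>.\<close>

definition bridge_pairs :: "(nat \<Rightarrow> nat \<Rightarrow> real) \<Rightarrow> nat \<Rightarrow> nat set \<Rightarrow> nat \<Rightarrow> nat \<Rightarrow> real" where
  "bridge_pairs Q L T x x' = (\<Sum>z\<in>bin_walks L x. \<Sum>z'\<in>bin_walks L x'. pair_weight Q L T z z')"

text \<open>Decomposition at the first step: if it is shared, the states before and after it agree.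
  The other shared times move down by one.\<close>

lemma bridge_pairs_Suc:
  "bridge_pairs Q (Suc L) T x x' = (\<Sum>y\<in>{0, 1}. \<Sum>y'\<in>{0, 1}.
     (if 0 \<in> T then of_bool (x = x' \<and> y = y') * Q x y else Q x y * Q x' y') * bridge_pairs Q L {t. Suc t \<in> T} y y')"
proof -
  let ?q = "\<lambda>y y'. if 0 \<in> T then of_bool (x = x' \<and> y = y') * Q x y else Q x y * Q x' y'"
  have pw: "pair_weight Q (Suc L) T (case_nat x z) (case_nat x' z') = ?q (z 0) (z' 0) * pair_weight Q L {t. Suc t \<in> T} z z'" for z z'
    unfolding pair_weight_def by (simp only: prod.lessThan_Suc_shift nat.case mem_Collect_eq)
  have "bridge_pairs Q (Suc L) T x x' = (\<Sum>y\<in>{0, 1}. \<Sum>z\<in>bin_walks L y. \<Sum>y'\<in>{0, 1}. \<Sum>z'\<in>bin_walks L y'.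
      ?q y y' * pair_weight Q L {t. Suc t \<in> T} z z')"
    unfolding bridge_pairs_def sum_bin_walks_Suc pw using bin_walks_ends
    by (intro sum.cong refl) metis
  also have "\<dots> = (\<Sum>y\<in>{0, 1}. \<Sum>y'\<in>{0, 1}. \<Sum>z\<in>bin_walks L y. \<Sum>z'\<in>bin_walks L y'.
      ?q y y' * pair_weight Q L {t. Suc t \<in> T} z z')"
    by (intro sum.cong refl sum.swap)
  finally show ?thesis
    by (simp only: bridge_pairs_def sum_distrib_left)
qed


section \<open>Moment bounds for a binary matrix with constant row sums \<open>lam\<close>\<close>

context
  fixes \<beta> \<gamma> m lam \<theta> :: real and Q :: "nat \<Rightarrow> nat \<Rightarrow> real"
  assumes m: "0 < m" "m \<le> \<beta>" "m \<le> \<gamma>" "4 * m\<^sup>2 \<le> lam\<^sup>2 - lam"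
    and lam: "lam = \<beta> + \<gamma>" "1 < lam" and \<theta>: "\<theta> = 1 / lam"
    and Q: "Q = kron_matrix \<gamma> \<beta> \<gamma>"
begin

lemma Q_simps: "Q 0 0 = \<gamma>" "Q 1 1 = \<gamma>" "Q 0 1 = \<beta>" "Q 1 0 = \<beta>"
  by (auto simp: Q kron_matrix_def)

text \<open>By symmetry the column sums are \<open>lam\<close> as well, so each further step
  multiplies the sum over the starting points by \<open>lam\<close>.\<close>

lemma walk_total_bridge_sum: "walk_total Q L (bin_walks L 0) + walk_total Q L (bin_walks L 1) = lam ^ L"
proof (induction L)
  case 0
  then show ?case by (simp add: walk_total_def walk_weight_def)
next
  case (Suc L)
  have "walk_total Q (Suc L) (bin_walks (Suc L) 0) + walk_total Q (Suc L) (bin_walks (Suc L) 1)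
    = lam * (walk_total Q L (bin_walks L 0) + walk_total Q L (bin_walks L 1))"
    unfolding walk_total_bin_walks_Suc by (simp add: Q_simps[unfolded One_nat_def] lam algebra_simps)
  then show ?case using Suc by simp
qed

text \<open>Each row of \<open>Q\<close> dominates the row with both entries \<open>m\<close>. That
  part contributes exactly \<open>m * lam ^ L\<close>, and the rest, of total mass
  \<open>lam - 2 * m\<close>, is applied to the inductive lower bound. So, relative to
  \<open>lam ^ L\<close>, the gap to 1/2 shrinks by the factor \<open>1 - 2 * m / lam\<close> per
  step.\<close>

lemma walk_total_bridge_lower:
  assumes "x \<in> {0, 1}"
  shows "lam ^ L * (1 / 2 - (1 - 2 * m / lam) ^ L) \<le> walk_total Q L (bin_walks L x)"
  using assms
proof (induction L arbitrary: x)
  case 0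
  then show ?case by (auto simp: walk_total_def walk_weight_def)
next
  case (Suc L)
  define w where "w = (\<lambda>y. walk_total Q L (bin_walks L y))"
  define b where "b = lam ^ L * (1 / 2 - (1 - 2 * m / lam) ^ L)"
  have w: "b \<le> w 0" "b \<le> w 1" "w 0 + w 1 = lam ^ L"
    using Suc.IH[of 0] Suc.IH[of 1] walk_total_bridge_sum by (auto simp: w_def b_def)
  have q: "m \<le> Q x 0" "m \<le> Q x 1" "Q x 0 + Q x 1 = lam"
    using Suc.prems m Q_simps lam by auto
  have "lam ^ Suc L * (1 / 2 - (1 - 2 * m / lam) ^ Suc L) = m * lam ^ L + (lam - 2 * m) * b"
  proof -
    define r where "r = 1 - 2 * m / lam"
    have lr: "lam * r = lam - 2 * m" using lam(2) by (simp add: r_def field_simps)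
    have "lam ^ Suc L * (1 / 2 - r ^ Suc L) = lam ^ L * (lam / 2 - (lam * r) * r ^ L)"
      by (simp add: algebra_simps)
    also have "\<dots> = m * lam ^ L + (lam - 2 * m) * (lam ^ L * (1 / 2 - r ^ L))"
      unfolding lr by (simp add: field_simps)
    finally show ?thesis unfolding b_def r_def .
  qed
  also have "\<dots> \<le> Q x 0 * w 0 + Q x 1 * w 1"
  proof -
    have "(Q x 0 - m) * b + (Q x 1 - m) * b \<le> (Q x 0 - m) * w 0 + (Q x 1 - m) * w 1"
      using w q by (intro add_mono mult_left_mono) auto
    moreover have "(Q x 0 - m) * b + (Q x 1 - m) * b = (lam - 2 * m) * b"
      unfolding q(3)[symmetric] by (simp add: algebra_simps)
    moreover have "(Q x 0 - m) * w 0 + (Q x 1 - m) * w 1 = Q x 0 * w 0 + Q x 1 * w 1 - m * lam ^ L"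
      unfolding w(3)[symmetric] by (simp add: algebra_simps)
    ultimately show ?thesis by linarith
  qed
  also have "\<dots> = walk_total Q (Suc L) (bin_walks (Suc L) x)"
    unfolding walk_total_bin_walks_Suc w_def by simp
  finally show ?case .
qed

lemma bridge_pairs_nonneg: "x \<in> {0, 1} \<Longrightarrow> x' \<in> {0, 1} \<Longrightarrow> 0 \<le> bridge_pairs Q L T x x'"
proof (induction L arbitrary: T x x')
  case 0
  then show ?case by (auto simp: bridge_pairs_def pair_weight_def)
next
  case (Suc L)
  have "0 \<le> Q y y'" if "y \<in> {0, 1}" "y' \<in> {0, 1}" for y y'
    using that Q_simps m by auto
  then show ?case unfolding bridge_pairs_Suc using Suc
    by (intro sum_nonneg mult_nonneg_nonneg) auto
qed

text \<open>With the matrix \<open>S\<close> of pair sums scaled by \<open>lam\<^sup>-\<^sup>2\<^sup>L\<close>, a shared step multiplies both the mean of \<open>S\<close>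
  and its maximum by at most \<open>\<theta>\<close>, and a free step keeps the mean and contracts the excess of the maximum
  over the mean, as all transition probabilities are at least \<open>m / lam\<close>.\<close>

lemma bridge_pairs_bounds:
  assumes "T \<subseteq> {..<L}"
  shows "(\<Sum>x\<in>{0, 1}. \<Sum>x'\<in>{0, 1}. bridge_pairs Q L T x x') \<le> (lam\<^sup>2) ^ L * (if T = {} then 1 else \<theta>)
    \<and> (\<forall>x\<in>{0, 1}. \<forall>x'\<in>{0, 1}. bridge_pairs Q L T x x'
      \<le> (lam\<^sup>2) ^ L * ((if T = {} then 1 else \<theta>) / 4 + (1 - 4 * m\<^sup>2 / lam\<^sup>2) ^ L))"
  using assms
proof (induction L arbitrary: T)
  case 0
  then show ?case by (auto simp: bridge_pairs_def pair_weight_def)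
next
  case (Suc L T)
  define T' where "T' = {t. Suc t \<in> T}"
  define S where "S = bridge_pairs Q L T'"
  define e where "e = 1 - 4 * m\<^sup>2 / lam\<^sup>2"
  \<comment> \<open>However many steps are shared, only one factor \<open>\<theta>\<close> is
    kept.\<close>
  define \<kappa> where "\<kappa> T = (if T = {} then 1 else \<theta>)" for T :: "nat set"
  define B where "B = (lam\<^sup>2) ^ L * (\<kappa> T' / 4 + e ^ L)"
  have th: "0 < \<theta>" "\<theta> < 1" "lam * \<theta> = 1" unfolding \<theta> using lam(2) by simp_all
  \<comment> \<open>Here \<open>4 * m\<^sup>2 \<le> lam\<^sup>2 - lam\<close> enters: the factor
    \<open>\<theta>\<close> of a shared step is at most the contraction factor \<open>e\<close> of a
    free step, so one error term \<open>e ^ L\<close> serves for both kinds.\<close>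
  have e\<theta>: "\<theta> \<le> e"
  proof -
    have "4 * m\<^sup>2 / lam\<^sup>2 \<le> (lam\<^sup>2 - lam) / lam\<^sup>2" using m by (intro divide_right_mono) auto
    also have "\<dots> = 1 - \<theta>" using lam(2) \<theta> by (simp add: field_simps power2_eq_square)
    finally show ?thesis by (simp add: e_def)
  qed
  have T': "T' \<subseteq> {..<L}" using Suc.prems by (auto simp: T'_def)
  have \<kappa>0: "\<kappa> T = \<theta> \<and> \<theta> * \<kappa> T' \<le> \<theta>" if "0 \<in> T" using that th by (auto simp: \<kappa>_def)
  have \<kappa>1: "\<kappa> T = \<kappa> T'" if "0 \<notin> T"
  proof -
    have "T \<subseteq> Suc ` T'"
    proof
      fix t assume "t \<in> T"
      then show "t \<in> Suc ` T'" using that by (cases t) (auto simp: T'_def)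
    qed
    then have "T = {} \<longleftrightarrow> T' = {}" by (auto simp: T'_def)
    then show ?thesis by (simp add: \<kappa>_def)
  qed
  have S0: "0 \<le> S y y'" if "y \<in> {0, 1}" "y' \<in> {0, 1}" for y y'
    unfolding S_def by (rule bridge_pairs_nonneg[OF that])
  have IH: "S 0 0 + S 0 1 + S 1 0 + S 1 1 \<le> (lam\<^sup>2) ^ L * \<kappa> T'"
    "\<And>y y'. y \<in> {0, 1} \<Longrightarrow> y' \<in> {0, 1} \<Longrightarrow> S y y' \<le> B"
  proof -
    note ih = Suc.IH[OF T', folded \<kappa>_def e_def S_def, folded B_def]
    show "S 0 0 + S 0 1 + S 1 0 + S 1 1 \<le> (lam\<^sup>2) ^ L * \<kappa> T'"
      using conjunct1[OF ih] by simp
    show "S y y' \<le> B" if "y \<in> {0, 1}" "y' \<in> {0, 1}" for y y'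
      using conjunct2[OF ih] that by blast
  qed
  have step: "bridge_pairs Q (Suc L) T x x' = (if 0 \<in> T then of_bool (x = x') * (Q x 0 * S 0 0 + Q x 1 * S 1 1)
     else Q x 0 * Q x' 0 * S 0 0 + Q x 0 * Q x' 1 * S 0 1 + Q x 1 * Q x' 0 * S 1 0 + Q x 1 * Q x' 1 * S 1 1)" for x x'
    unfolding bridge_pairs_Suc T'_def[symmetric] S_def by simp
  \<comment> \<open>Column sums, because the totals below run over the starting points.\<close>
  have col: "Q 0 0 + Q 1 0 = lam" "Q 0 1 + Q 1 1 = lam" by (simp_all only: Q_simps lam(1) add.commute)
  have "(\<Sum>x\<in>{0, 1}. \<Sum>x'\<in>{0, 1}. bridge_pairs Q (Suc L) T x x') \<le> (lam\<^sup>2) ^ Suc L * \<kappa> T"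
  proof (cases "0 \<in> T")
    case True
    have "(\<Sum>x\<in>{0, 1}. \<Sum>x'\<in>{0, 1}. bridge_pairs Q (Suc L) T x x') = lam * (S 0 0 + S 1 1)"
    proof -
      have "(\<Sum>x\<in>{0, 1}. \<Sum>x'\<in>{0, 1}. bridge_pairs Q (Suc L) T x x')
          = (Q 0 0 + Q 1 0) * S 0 0 + (Q 0 1 + Q 1 1) * S 1 1"
        using True by (simp add: step distrib_right)
      then show ?thesis unfolding col by (simp only: distrib_left)
    qed
    also have "\<dots> \<le> lam * ((lam\<^sup>2) ^ L * \<kappa> T')"
      using IH(1) S0[of 0 1] S0[of 1 0] lam(2) by (intro mult_left_mono) auto
    also have "\<dots> = (lam\<^sup>2) ^ Suc L * (\<theta> * \<kappa> T')" using th(3) by (simp add: power2_eq_square)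
    also have "\<dots> \<le> (lam\<^sup>2) ^ Suc L * \<theta>" using \<kappa>0[OF True] by (intro mult_left_mono) auto
    finally show ?thesis using \<kappa>0[OF True] by simp
  next
    case False
    have "(\<Sum>x\<in>{0, 1}. \<Sum>x'\<in>{0, 1}. bridge_pairs Q (Suc L) T x x') = lam\<^sup>2 * (S 0 0 + S 0 1 + S 1 0 + S 1 1)"
    proof -
      have "(\<Sum>x\<in>{0, 1}. \<Sum>x'\<in>{0, 1}. bridge_pairs Q (Suc L) T x x')
          = (Q 0 0 + Q 1 0) * (Q 0 0 + Q 1 0) * S 0 0 + (Q 0 0 + Q 1 0) * (Q 0 1 + Q 1 1) * S 0 1
          + (Q 0 1 + Q 1 1) * (Q 0 0 + Q 1 0) * S 1 0 + (Q 0 1 + Q 1 1) * (Q 0 1 + Q 1 1) * S 1 1"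
        using False by (simp add: step distrib_left distrib_right)
      then show ?thesis unfolding col by (simp only: distrib_left power2_eq_square)
    qed
    also have "\<dots> \<le> lam\<^sup>2 * ((lam\<^sup>2) ^ L * \<kappa> T')"
      using IH(1) by (intro mult_left_mono) auto
    finally show ?thesis using \<kappa>1[OF False] by (simp add: mult.assoc)
  qed
  moreover have "bridge_pairs Q (Suc L) T x x' \<le> (lam\<^sup>2) ^ Suc L * (\<kappa> T / 4 + e ^ Suc L)"
    if 2: "x \<in> {0, 1}" "x' \<in> {0, 1}" for x x'
  proof -
    have q: "Q y 0 + Q y 1 = lam" "m \<le> Q y 0" "m \<le> Q y 1" if "y \<in> {0, 1}" for y
      using that Q_simps lam m by auto
    \<comment> \<open>Relative to \<open>lam\<^sup>2\<close>, a shared step has total weight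
      \<open>\<theta>\<close>.\<close>
    have l2: "lam\<^sup>2 * \<theta> = lam" using th(3) by (simp add: power2_eq_square mult.assoc)
    have el: "lam\<^sup>2 * e = lam\<^sup>2 - 4 * m\<^sup>2" using lam(2) by (simp add: e_def field_simps)
    show ?thesis
    proof (cases "0 \<in> T")
      case True
      have "bridge_pairs Q (Suc L) T x x' \<le> Q x 0 * S 0 0 + Q x 1 * S 1 1"
        using True q(2,3)[OF 2(1)] m(1) S0 by (auto simp: step)
      also have "\<dots> \<le> Q x 0 * B + Q x 1 * B"
        using q[OF 2(1)] m(1) IH(2) by (intro add_mono mult_left_mono) auto
      also have "\<dots> = lam * B" using q[OF 2(1)] by (simp add: distrib_right[symmetric])
      also have "\<dots> = (lam\<^sup>2) ^ Suc L * (\<theta> * \<kappa> T' / 4 + \<theta> * e ^ L)"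
        unfolding B_def by (subst l2[symmetric]) (simp add: algebra_simps)
      also have "\<dots> \<le> (lam\<^sup>2) ^ Suc L * (\<kappa> T / 4 + e * e ^ L)"
        using \<kappa>0[OF True] e\<theta> th by (intro mult_left_mono add_mono mult_right_mono) auto
      finally show ?thesis by simp
    next
      case False
      \<comment> \<open>Removing \<open>m\<^sup>2\<close> from each weight
        \<open>Q x y * Q x' y'\<close> leaves nonnegative weights of total
        \<open>lam\<^sup>2 * e\<close>. The removed part sees only the sum of all entries of
        \<open>S\<close>; in the rest, each entry is bounded by \<open>B\<close>.\<close>
      define R where "R = (\<lambda>y y'. Q x y * Q x' y' - m\<^sup>2)"
      have R0: "0 \<le> R y y'" if "y \<in> {0, 1}" "y' \<in> {0, 1}" for y y'
      proof -
        have "m \<le> Q x y" "m \<le> Q x' y'" using that q(2,3)[OF 2(1)] q(2,3)[OF 2(2)] by auto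
        then have "m * m \<le> Q x y * Q x' y'" by (rule mult_mono) (use m(1) \<open>m \<le> Q x y\<close> in auto)
        then show ?thesis by (simp add: R_def power2_eq_square)
      qed
      have "(Q x 0 + Q x 1) * (Q x' 0 + Q x' 1) = lam\<^sup>2"
        unfolding q(1)[OF 2(1)] q(1)[OF 2(2)] by (simp add: power2_eq_square)
      then have Rs: "R 0 0 + R 0 1 + R 1 0 + R 1 1 = lam\<^sup>2 * e"
        unfolding R_def el by (simp add: algebra_simps)
      have QR: "Q x y * Q x' y' = R y y' + m\<^sup>2" for y y' by (simp add: R_def)
      have a1: "bridge_pairs Q (Suc L) T x x' = m\<^sup>2 * (S 0 0 + S 0 1 + S 1 0 + S 1 1)
          + (R 0 0 * S 0 0 + R 0 1 * S 0 1 + R 1 0 * S 1 0 + R 1 1 * S 1 1)"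
        using False unfolding step QR by (simp add: distrib_left distrib_right)
      have a2: "m\<^sup>2 * (S 0 0 + S 0 1 + S 1 0 + S 1 1) \<le> m\<^sup>2 * ((lam\<^sup>2) ^ L * \<kappa> T')"
        using IH(1) by (rule mult_left_mono) simp
      have RB: "R y y' * S y y' \<le> R y y' * B" if "y \<in> {0, 1}" "y' \<in> {0, 1}" for y y'
        by (rule mult_left_mono[OF IH(2)[OF that] R0[OF that]])
      have "R 0 0 * S 0 0 + R 0 1 * S 0 1 + R 1 0 * S 1 0 + R 1 1 * S 1 1
          \<le> R 0 0 * B + R 0 1 * B + R 1 0 * B + R 1 1 * B"
        using RB by (intro add_mono) simp_all
      also have "\<dots> = lam\<^sup>2 * e * B"
        unfolding Rs[symmetric] by (simp only: distrib_right)
      finally have "bridge_pairs Q (Suc L) T x x' \<le> m\<^sup>2 * ((lam\<^sup>2) ^ L * \<kappa> T') + lam\<^sup>2 * e * B"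
        unfolding a1 using a2 by linarith
      also have "\<dots> = (lam\<^sup>2) ^ Suc L * (\<kappa> T' / 4 + e ^ Suc L)"
      proof -
        have m4: "m\<^sup>2 = (lam\<^sup>2 - lam\<^sup>2 * e) / 4" using el by simp
        show ?thesis unfolding B_def m4 by (simp add: field_simps)
      qed
      finally show ?thesis using \<kappa>1[OF False] by simp
    qed
  qed
  ultimately show ?case unfolding \<kappa>_def e_def by blast
qed

end

text \<open>After division by \<open>lam ^ (2 * L)\<close>, the bound on the pair total tends to
  \<open>1 / (4 * lam)\<close>, and the lower bound on the squared walk total tends to 1/4. So any
  ratio strictly between \<open>1 / lam\<close> and 1 is achieved for large
  \<open>L\<close>.\<close>

lemma expanding_bridges:
  fixes \<beta> \<gamma> :: real
  assumes "0 < \<beta>" "0 < \<gamma>" "\<beta> + \<gamma> > 1"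
  obtains L \<theta> where "3 \<le> L" "0 < \<theta>" "\<theta> < 1"
    "\<And>x. x \<in> {0, 1} \<Longrightarrow> walk_total (kron_matrix \<gamma> \<beta> \<gamma>) L (bin_walks L x) > 0"
    "\<And>x T. x \<in> {0, 1} \<Longrightarrow> T \<subseteq> {..<L} \<Longrightarrow> T \<noteq> {} \<Longrightarrow>
      pair_total (kron_matrix \<gamma> \<beta> \<gamma>) L T (bin_walks L x)
        \<le> \<theta> * (walk_total (kron_matrix \<gamma> \<beta> \<gamma>) L (bin_walks L x))\<^sup>2"
proof -
  define Q where "Q = kron_matrix \<gamma> \<beta> \<gamma>"
  define lam where "lam = \<beta> + \<gamma>"
  \<comment> \<open>The cap 1 gives \<open>m\<^sup>2 \<le> m\<close>, so the last entry yields
    \<open>4 * m\<^sup>2 \<le> lam\<^sup>2 - lam\<close>.\<close>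
  define m where "m = min (min \<beta> \<gamma>) (min 1 ((lam\<^sup>2 - lam) / 4))"
  define \<theta> where "\<theta> = 1 / lam"
  define r where "r = 1 - 2 * m / lam"
  define e where "e = 1 - 4 * m\<^sup>2 / lam\<^sup>2"
  have lam: "1 < lam" using assms by (simp add: lam_def)
  then have "lam * 1 < lam * lam" by (intro mult_strict_left_mono) auto
  then have ll: "0 < lam\<^sup>2 - lam" by (simp add: power2_eq_square)
  have "0 < m" using assms ll by (simp add: m_def)
  moreover have "m \<le> \<beta>" "m \<le> \<gamma>" "m \<le> 1" "m \<le> (lam\<^sup>2 - lam) / 4"
    unfolding m_def by linarith+
  ultimately have m: "0 < m" "m \<le> \<beta>" "m \<le> \<gamma>" "m \<le> 1" "4 * m \<le> lam\<^sup>2 - lam" by simp_all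
  have "m * m \<le> m * 1" using m by (intro mult_left_mono) auto
  then have m2: "4 * m\<^sup>2 \<le> lam\<^sup>2 - lam" using m(5) by (simp add: power2_eq_square)
  have r: "\<bar>r\<bar> < 1"
  proof -
    have "2 * m / lam \<le> 1" "0 < 2 * m / lam" using m lam by (simp_all add: lam_def)
    then show ?thesis by (simp add: r_def)
  qed
  have e: "\<bar>e\<bar> < 1"
  proof -
    have "4 * m\<^sup>2 < lam\<^sup>2" using m2 lam by linarith
    then have "4 * m\<^sup>2 / lam\<^sup>2 < 1" "0 < 4 * m\<^sup>2 / lam\<^sup>2" using m(1) lam by simp_all
    then show ?thesis by (simp add: e_def)
  qed
  have th: "0 < \<theta>" "\<theta> < 1" using lam by (auto simp: \<theta>_def)
  \<comment> \<open>The midpoint of \<open>\<theta>\<close> and 1 leaves room for the error terms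
    \<open>e ^ L\<close> and \<open>r ^ L\<close>.\<close>
  define \<theta>' where "\<theta>' = (1 + \<theta>) / 2"
  have th': "0 < \<theta>'" "\<theta>' < 1" "\<theta> < \<theta>'" using th by (auto simp: \<theta>'_def)
  have lim_r: "(\<lambda>L. r ^ L) \<longlonglongrightarrow> 0" and lim_e: "(\<lambda>L. e ^ L) \<longlonglongrightarrow> 0"
    using r e by (auto intro: LIMSEQ_power_zero)
  have "(\<lambda>L. \<theta> / 4 + e ^ L - \<theta>' * (1 / 2 - r ^ L)\<^sup>2) \<longlonglongrightarrow> \<theta> / 4 + 0 - \<theta>' * (1 / 2 - 0)\<^sup>2"
    by (rule tendsto_diff[OF tendsto_add[OF tendsto_const lim_e]
          tendsto_mult[OF tendsto_const tendsto_power[OF tendsto_diff[OF tendsto_const lim_r]]]])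
  moreover have "\<theta> / 4 + 0 - \<theta>' * (1 / 2 - 0)\<^sup>2 < 0" using th' by (simp add: power2_eq_square)
  ultimately have "eventually (\<lambda>L. \<theta> / 4 + e ^ L - \<theta>' * (1 / 2 - r ^ L)\<^sup>2 < 0) sequentially"
    by (rule order_tendstoD(2))
  moreover have "eventually (\<lambda>L. r ^ L < 1 / 2) sequentially"
    using lim_r by (rule order_tendstoD(2)) simp
  ultimately have "eventually (\<lambda>L. \<theta> / 4 + e ^ L - \<theta>' * (1 / 2 - r ^ L)\<^sup>2 < 0 \<and> r ^ L < 1 / 2 \<and> 3 \<le> L) sequentially"
    using eventually_ge_at_top[of 3] by eventually_elim auto
  then have "\<exists>L. \<theta> / 4 + e ^ L - \<theta>' * (1 / 2 - r ^ L)\<^sup>2 < 0 \<and> r ^ L < 1 / 2 \<and> 3 \<le> L"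
    by (rule eventually_happens'[OF sequentially_bot])
  then obtain L where "\<theta> / 4 + e ^ L - \<theta>' * (1 / 2 - r ^ L)\<^sup>2 < 0 \<and> r ^ L < 1 / 2 \<and> 3 \<le> L" ..
  then have L: "\<theta> / 4 + e ^ L \<le> \<theta>' * (1 / 2 - r ^ L)\<^sup>2" "r ^ L < 1 / 2" "3 \<le> L" by simp_all
  note ctx = m(1-3) m2 lam_def lam \<theta>_def Q_def
  have low: "lam ^ L * (1 / 2 - r ^ L) \<le> walk_total Q L (bin_walks L x)" if "x \<in> {0, 1}" for x
    unfolding r_def by (rule walk_total_bridge_lower[OF ctx that])
  have pos: "0 < lam ^ L * (1 / 2 - r ^ L)" using L lam by simp
  have "pair_total Q L T (bin_walks L x) \<le> \<theta>' * (walk_total Q L (bin_walks L x))\<^sup>2"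
    if h: "x \<in> {0, 1}" "T \<subseteq> {..<L}" "T \<noteq> {}" for x T
  proof -
    have "pair_total Q L T (bin_walks L x) = bridge_pairs Q L T x x"
      by (simp add: pair_total_def bridge_pairs_def)
    also have "\<dots> \<le> (lam\<^sup>2) ^ L * (\<theta> / 4 + e ^ L)"
      using bridge_pairs_bounds[OF ctx h(2)] h(1,3) by (auto simp: e_def)
    also have "\<dots> \<le> (lam\<^sup>2) ^ L * (\<theta>' * (1 / 2 - r ^ L)\<^sup>2)" using L(1) by (intro mult_left_mono) auto
    also have "\<dots> = \<theta>' * (lam ^ L * (1 / 2 - r ^ L))\<^sup>2"
      by (simp add: power_mult_distrib power_mult[symmetric] mult.commute)
    also have "\<dots> \<le> \<theta>' * (walk_total Q L (bin_walks L x))\<^sup>2"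
      using low[OF h(1)] pos th' by (intro mult_left_mono power_mono) auto
    finally show ?thesis .
  qed
  moreover have "walk_total Q L (bin_walks L x) > 0" if "x \<in> {0, 1}" for x
    using low[OF that] pos by linarith
  ultimately show thesis using that[of L \<theta>'] L(3) th' unfolding Q_def by blast
qed

section \<open>Alternating walks with one pause\<close>

text \<open>The walk \<open>1, 0, 1, 0, \<dots>\<close> that stays at \<open>1\<close> in its step \<open>2j\<close>, which is the only step of weight \<open>\<alpha>\<close>,
  and continues with the opposite parity.\<close>

definition shift_walk :: "nat \<Rightarrow> nat \<Rightarrow> nat" where
  "shift_walk j t = (if even t \<longleftrightarrow> t \<le> 2 * j then 1 else 0)"

context
  fixes \<alpha> :: real and k L :: nat and P :: "nat \<Rightarrow> nat \<Rightarrow> real"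
  assumes \<alpha>: "0 < \<alpha>" "\<alpha> \<le> 1" and k: "2 \<le> k" "1 < \<alpha> * k" and L: "L = 2 * k - 1"
    and P: "P = kron_matrix \<alpha> 1 0"
begin

lemma shift_walk_step: "P (shift_walk j t) (shift_walk j (Suc t)) = (if t = 2 * j then \<alpha> else 1)"
proof (cases "t = 2 * j")
  case True
  then show ?thesis by (simp add: shift_walk_def P kron_matrix_def)
next
  case False
  then have "t \<le> 2 * j \<longleftrightarrow> Suc t \<le> 2 * j" by linarith
  then show ?thesis using False by (simp add: shift_walk_def P kron_matrix_def)
qed

text \<open>The position of the pause identifies the walk. Hence the walks are distinct, and two of
  them cannot share the pausing step of either.\<close>

lemma shift_walk_turn:
  "shift_walk j' (2 * j) = shift_walk j' (Suc (2 * j)) \<longleftrightarrow> j' = j"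
proof -
  have "2 * j \<le> 2 * j' \<longleftrightarrow> j \<le> j'" "Suc (2 * j) \<le> 2 * j' \<longleftrightarrow> j < j'" by linarith+
  then show ?thesis by (auto simp: shift_walk_def)
qed

lemma inj_shift_walk: "inj_on shift_walk A"
  by (rule inj_onI) (metis shift_walk_turn)

lemma walk_weight_shift:
  assumes "j < k"
  shows "walk_weight P L (shift_walk j) = \<alpha>"
proof -
  have "2 * j < L" using assms L by linarith
  then show ?thesis unfolding walk_weight_def shift_walk_step by simp
qed

lemma walk_total_shift: "walk_total P L (shift_walk ` {..<k}) = \<alpha> * k"
proof -
  have "walk_total P L (shift_walk ` {..<k}) = (\<Sum>j<k. walk_weight P L (shift_walk j))"
    unfolding walk_total_def by (simp add: sum.reindex[OF inj_shift_walk])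
  also have "\<dots> = (\<Sum>j<k. \<alpha>)" by (intro sum.cong) (auto simp: walk_weight_shift)
  finally show ?thesis by simp
qed

lemma pair_total_shift:
  "pair_total P L T (shift_walk ` {..<k}) = (\<Sum>j<k. \<Sum>j'<k. pair_weight P L T (shift_walk j) (shift_walk j'))"
  unfolding pair_total_def by (simp add: sum.reindex[OF inj_shift_walk])

lemma pair_weight_shift_zero:
  assumes "t \<in> T" "t < L" "shift_walk j t \<noteq> shift_walk j' t \<or> shift_walk j (Suc t) \<noteq> shift_walk j' (Suc t)"
  shows "pair_weight P L T (shift_walk j) (shift_walk j') = 0"
  unfolding pair_weight_def by (rule prod_zero) (use assms in auto)

text \<open>If a pausing step is charged as shared, the walks must coincide, and the single weight
  \<open>\<alpha>\<close> is counted once; otherwise each walk pays for its own pause, which gives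
  \<open>\<alpha>\<^sup>2\<close>.\<close>

lemma pair_weight_shift_le:
  assumes j: "j < k" "j' < k"
  shows "pair_weight P L T (shift_walk j) (shift_walk j')
    \<le> (if 2 * j \<in> T then (if j = j' then \<alpha> else 0) else 0)
      + (if 2 * j \<notin> T \<and> 2 * j' \<notin> T then \<alpha>\<^sup>2 else 0)"
proof -
  have jL: "2 * j < L" "2 * j' < L" using j L by linarith+
  define w where "w = (\<lambda>i t :: nat. if t = 2 * i then \<alpha> else 1)"
  have w: "0 \<le> w i t" "w i t \<le> 1" for i t using \<alpha> by (auto simp: w_def)
  have prod_w: "(\<Prod>t<L. w i t) = \<alpha>" if "2 * i < L" for i
    unfolding w_def using that by simp
  have pw: "pair_weight P L T (shift_walk j) (shift_walk j') = (\<Prod>t<L. if t \<in> T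
     then of_bool (shift_walk j t = shift_walk j' t \<and> shift_walk j (Suc t) = shift_walk j' (Suc t)) * w j t
     else w j t * w j' t)"
    unfolding pair_weight_def shift_walk_step w_def by simp
  consider "2 * j \<in> T" "j = j'" | "j \<noteq> j'" "2 * j \<in> T \<or> 2 * j' \<in> T" | "2 * j \<notin> T" "2 * j' \<notin> T" by blast
  then show ?thesis
  proof cases
    case 1
    have "pair_weight P L T (shift_walk j) (shift_walk j') \<le> (\<Prod>t<L. w j t)"
      unfolding pw
    proof (rule prod_mono)
      fix t
      show "0 \<le> (if t \<in> T
         then of_bool (shift_walk j t = shift_walk j' t \<and> shift_walk j (Suc t) = shift_walk j' (Suc t)) * w j t
         else w j t * w j' t) \<and> (if t \<in> T
         then of_bool (shift_walk j t = shift_walk j' t \<and> shift_walk j (Suc t) = shift_walk j' (Suc t)) * w j t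
         else w j t * w j' t) \<le> w j t"
        using w[of j t] w[of j' t] by (auto simp: mult_left_le)
    qed
    then show ?thesis using 1 prod_w[OF jL(1)] by simp
  next
    case 2
    have "shift_walk j (2 * i) \<noteq> shift_walk j' (2 * i) \<or> shift_walk j (Suc (2 * i)) \<noteq> shift_walk j' (Suc (2 * i))"
      if "i = j \<or> i = j'" for i
      using shift_walk_turn[of j i] shift_walk_turn[of j' i] that 2(1) by metis
    then have "pair_weight P L T (shift_walk j) (shift_walk j') = 0"
      using 2(2) jL pair_weight_shift_zero by metis
    then show ?thesis using \<alpha> by simp
  next
    case 3
    have "pair_weight P L T (shift_walk j) (shift_walk j') \<le> (\<Prod>t<L. w j t * w j' t)"
      unfolding pw
    proof (rule prod_mono)
      fix t
      have "w j t = 1 \<and> w j' t = 1" if "t \<in> T" using that 3 by (auto simp: w_def)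
      then show "0 \<le> (if t \<in> T
         then of_bool (shift_walk j t = shift_walk j' t \<and> shift_walk j (Suc t) = shift_walk j' (Suc t)) * w j t
         else w j t * w j' t) \<and> (if t \<in> T
         then of_bool (shift_walk j t = shift_walk j' t \<and> shift_walk j (Suc t) = shift_walk j' (Suc t)) * w j t
         else w j t * w j' t) \<le> w j t * w j' t"
        using w[of j t] w[of j' t] by simp
    qed
    also have "\<dots> = \<alpha>\<^sup>2" using prod_w jL by (simp add: prod.distrib power2_eq_square)
    finally show ?thesis using 3 by simp
  qed
qed

text \<open>If \<open>T\<close> contains \<open>d > 0\<close> of the \<open>k\<close> pausing steps,
  the total is at most \<open>\<alpha> * d + (\<alpha> * (k - d))\<^sup>2\<close>, and
  \<open>\<alpha> * k > 1\<close> makes this smaller than \<open>(\<alpha> * k)\<^sup>2\<close>. If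
  it contains none, every pair contributes at most \<open>\<alpha>\<^sup>2\<close>, and some pair
  contributes 0.\<close>

lemma pair_total_shift_less:
  assumes T: "T \<subseteq> {..<L}" "T \<noteq> {}"
  shows "pair_total P L T (shift_walk ` {..<k}) < (walk_total P L (shift_walk ` {..<k}))\<^sup>2"
proof -
  define D where "D = {j. j < k \<and> 2 * j \<in> T}"
  have D: "D \<subseteq> {..<k}" "finite D" by (auto simp: D_def)
  have k2: "(\<alpha> * real k)\<^sup>2 = \<alpha>\<^sup>2 * real k * real k" by (simp add: power2_eq_square)
  have "pair_total P L T (shift_walk ` {..<k}) < (\<alpha> * real k)\<^sup>2"
  proof (cases "D = {}")
    case False
    define d where "d = card D"
    have d: "1 \<le> d" "d \<le> k" using False D card_mono[OF _ D(1)] by (auto simp: d_def Suc_le_eq card_gt_0_iff)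
    have cD: "real (card ({..<k} - D)) = real k - real d"
      using card_Diff_subset[OF D(2,1)] d by (simp add: d_def of_nat_diff)
    have "pair_total P L T (shift_walk ` {..<k})
      \<le> (\<Sum>j<k. \<Sum>j'<k. (if j \<in> D then (if j = j' then \<alpha> else 0) else 0)
          + (if j \<in> {..<k} - D then \<alpha> else 0) * (if j' \<in> {..<k} - D then \<alpha> else 0))"
      unfolding pair_total_shift
    proof (intro sum_mono)
      fix j j' assume "j \<in> {..<k}" "j' \<in> {..<k}"
      then show "pair_weight P L T (shift_walk j) (shift_walk j')
        \<le> (if j \<in> D then (if j = j' then \<alpha> else 0) else 0)
          + (if j \<in> {..<k} - D then \<alpha> else 0) * (if j' \<in> {..<k} - D then \<alpha> else 0)"
        using pair_weight_shift_le[of j j' T] by (auto simp: D_def power2_eq_square split: if_splits)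
    qed
    also have "\<dots> = (\<Sum>j<k. if j \<in> D then \<alpha> else 0)
        + (\<Sum>j<k. if j \<in> {..<k} - D then \<alpha> else 0) * (\<Sum>j'<k. if j' \<in> {..<k} - D then \<alpha> else 0)"
    proof -
      have "(\<Sum>j'<k. if j \<in> D then (if j = j' then \<alpha> else 0) else 0) = (if j \<in> D then \<alpha> else 0)" if "j < k" for j
        using that by simp
      then show ?thesis unfolding sum.distrib sum_product by simp
    qed
    also have "(\<Sum>j<k. if j \<in> D then \<alpha> else 0) = \<alpha> * d"
      using D by (simp add: sum.If_cases Int_absorb1 d_def)
    also have "(\<Sum>j<k. if j \<in> {..<k} - D then \<alpha> else 0) = \<alpha> * (real k - real d)"
    proof -
      have "(\<Sum>j<k. if j \<in> {..<k} - D then \<alpha> else 0) = (\<Sum>j\<in>{..<k} - D. \<alpha>)"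
        by (rule sum.mono_neutral_cong_right) auto
      then show ?thesis using cD by simp
    qed
    \<comment> \<open>The difference of the two squares is
      \<open>\<alpha>\<^sup>2 * d * (2 * k - d)\<close>, where
      \<open>2 * k - d \<ge> k\<close>.\<close>
    also have "\<alpha> * real d + \<alpha> * (real k - real d) * (\<alpha> * (real k - real d)) < (\<alpha> * real k)\<^sup>2"
    proof -
      have "\<alpha> * real d * 1 < \<alpha> * real d * (\<alpha> * real k)"
        using \<alpha> d k(2) by (intro mult_strict_left_mono) auto
      also have "\<dots> \<le> \<alpha> * real d * (\<alpha> * (2 * real k - real d))"
        using \<alpha> d by (intro mult_left_mono) auto
      finally show ?thesis by (simp add: algebra_simps power2_eq_square)
    qed
    finally show ?thesis .
  next
    case True
    obtain t where t: "t \<in> T" using T(2) by blast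
    then have tL: "t < L" using T(1) by blast
    \<comment> \<open>The even times below \<open>L\<close> are exactly the pausing steps
      \<open>2 * j\<close> with \<open>j < k\<close>.\<close>
    have "odd t"
    proof
      assume "even t"
      then have "t div 2 \<in> D" using t tL L by (auto simp: D_def)
      then show False using True by blast
    qed
    then have t2: "0 < t" "t \<le> 2 * (k - 1)" using tL L by (cases t; auto)+
    \<comment> \<open>At the odd time \<open>t\<close>, walk 0 has passed its pause and walk
      \<open>k - 1\<close> has not, so they have opposite values.\<close>
    have zero: "pair_weight P L T (shift_walk 0) (shift_walk (k - 1)) = 0"
      by (rule pair_weight_shift_zero[OF t tL]) (use t2 \<open>odd t\<close> in \<open>simp add: shift_walk_def\<close>)
    have "pair_total P L T (shift_walk ` {..<k}) = (\<Sum>(j, j')\<in>{..<k} \<times> {..<k}. pair_weight P L T (shift_walk j) (shift_walk j'))"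
      unfolding pair_total_shift by (simp add: sum.cartesian_product)
    also have "\<dots> < (\<Sum>(j, j')\<in>{..<k} \<times> {..<k}. \<alpha>\<^sup>2)"
    proof (rule sum_strict_mono_ex1)
      show "\<forall>x\<in>{..<k} \<times> {..<k}. (case x of (j, j') \<Rightarrow> pair_weight P L T (shift_walk j) (shift_walk j'))
          \<le> (case x of (j, j') \<Rightarrow> \<alpha>\<^sup>2)"
      proof safe
        fix j j' assume jj: "j < k" "j' < k"
        then have "2 * j \<notin> T" "2 * j' \<notin> T" using True by (auto simp: D_def)
        then show "pair_weight P L T (shift_walk j) (shift_walk j') \<le> \<alpha>\<^sup>2"
          using pair_weight_shift_le[OF jj, of T] by simp
      qed
      show "\<exists>x\<in>{..<k} \<times> {..<k}. (case x of (j, j') \<Rightarrow> pair_weight P L T (shift_walk j) (shift_walk j'))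
          < (case x of (j, j') \<Rightarrow> \<alpha>\<^sup>2)"
        by (rule bexI[of _ "(0, k - 1)"]) (use zero \<alpha> k in auto)
    qed simp
    also have "\<dots> = (\<alpha> * real k)\<^sup>2" unfolding k2 by simp
    finally show ?thesis .
  qed
  then show ?thesis unfolding walk_total_shift .
qed

end

text \<open>A coordinate starting at 0 only alternates, which has weight 1 in each step when \<beta>
  = 1. It is 1 at odd times, hence at the end of a walk of odd length
  \<open>2 * k - 1\<close>.\<close>

definition swap_walks :: "nat \<Rightarrow> nat \<Rightarrow> (nat \<Rightarrow> nat) set" where
  "swap_walks k x = (if x = 1 then shift_walk ` {..<k} else {\<lambda>t. if even t then 0 else 1})"

lemma swapping_bridges:
  fixes \<alpha> :: real
  assumes \<alpha>: "0 < \<alpha>" "\<alpha> \<le> 1"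
  obtains L k \<theta> where "3 \<le> L" "0 < \<theta>" "\<theta> < 1"
    "\<And>x z. x \<in> {0, 1} \<Longrightarrow> z \<in> swap_walks k x \<Longrightarrow> z 0 = x \<and> z L = 1"
    "\<And>x. x \<in> {0, 1} \<Longrightarrow> walk_total (kron_matrix \<alpha> 1 0) L (swap_walks k x) > 0"
    "\<And>x T. x \<in> {0, 1} \<Longrightarrow> T \<subseteq> {..<L} \<Longrightarrow> T \<noteq> {} \<Longrightarrow>
      pair_total (kron_matrix \<alpha> 1 0) L T (swap_walks k x)
        \<le> (walk_total (kron_matrix \<alpha> 1 0) L (swap_walks k x))\<^sup>2"
    "\<And>T. T \<subseteq> {..<L} \<Longrightarrow> T \<noteq> {} \<Longrightarrow>
      pair_total (kron_matrix \<alpha> 1 0) L T (swap_walks k 1)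
        \<le> \<theta> * (walk_total (kron_matrix \<alpha> 1 0) L (swap_walks k 1))\<^sup>2"
proof -
  define P where "P = kron_matrix \<alpha> 1 0"
  obtain k0 :: nat where k0: "1 / \<alpha> < k0" using reals_Archimedean2 by blast
  define k where "k = max 2 k0"
  have "1 < \<alpha> * k0" using k0 \<alpha> by (simp add: field_simps)
  also have "\<dots> \<le> \<alpha> * k" using \<alpha> by (intro mult_left_mono) (auto simp: k_def)
  finally have k: "2 \<le> k" "1 < \<alpha> * k" by (auto simp: k_def)
  define L where "L = 2 * k - 1"
  note ctx = \<alpha> k L_def P_def
  define W where "W = (walk_total P L (shift_walk ` {..<k}))\<^sup>2"
  have W: "0 < W" unfolding W_def walk_total_shift[OF ctx] using k \<alpha> by simp
  define R where "R = (\<lambda>T. pair_total P L T (shift_walk ` {..<k}) / W) ` (Pow {..<L} - {{}})"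
  \<comment> \<open>A uniform bound below 1 exists because there are finitely many sets
    \<open>T\<close>; the entry 1/2 keeps the maximum positive.\<close>
  define \<theta> where "\<theta> = Max (insert (1 / 2) R)"
  have fin: "finite (insert (1 / 2) R)" by (simp add: R_def)
  have "r < 1" if "r \<in> insert (1 / 2) R" for r
  proof -
    from that consider "r = 1 / 2" | T where "T \<subseteq> {..<L}" "T \<noteq> {}" "r = pair_total P L T (shift_walk ` {..<k}) / W"
      by (auto simp: R_def)
    then show ?thesis
    proof cases
      case 2
      then show ?thesis using pair_total_shift_less[OF ctx 2(1,2)] W by (simp add: W_def)
    qed simp
  qed
  then have \<theta>1: "\<theta> < 1" unfolding \<theta>_def using fin by simp
  have "1 / 2 \<le> \<theta>" unfolding \<theta>_def using fin by (intro Max_ge) auto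
  then have \<theta>0: "0 < \<theta>" by simp
  have ratio: "pair_total P L T (swap_walks k 1) \<le> \<theta> * (walk_total P L (swap_walks k 1))\<^sup>2"
    if "T \<subseteq> {..<L}" "T \<noteq> {}" for T
  proof -
    have "pair_total P L T (shift_walk ` {..<k}) / W \<le> \<theta>"
      unfolding \<theta>_def using fin that by (intro Max_ge) (auto simp: R_def)
    then show ?thesis using W by (simp add: swap_walks_def W_def pos_divide_le_eq)
  qed
  define a :: "nat \<Rightarrow> nat" where "a = (\<lambda>t. if even t then 0 else 1)"
  have a: "swap_walks k 0 = {a}" by (simp add: swap_walks_def a_def)
  have alt: "P (a t) (a (Suc t)) = 1" for t
    by (simp add: P_def kron_matrix_def a_def)
  have tot0: "walk_total P L (swap_walks k 0) = 1"
    unfolding a walk_total_def walk_weight_def by (simp add: alt)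
  have pair0: "pair_total P L T (swap_walks k 0) = 1" for T
    unfolding a pair_total_def pair_weight_def by (simp add: alt cong: if_cong)
  show thesis
  proof (rule that[of L \<theta> k])
    show "3 \<le> L" using k by (simp add: L_def)
    show "z 0 = x \<and> z L = 1" if "x \<in> {0, 1}" "z \<in> swap_walks k x" for x z
      using that k(1) by (auto simp: swap_walks_def shift_walk_def L_def)
    show "walk_total (kron_matrix \<alpha> 1 0) L (swap_walks k x) > 0" if "x \<in> {0, 1}" for x
      unfolding P_def[symmetric] using that tot0 walk_total_shift[OF ctx] \<alpha> k
      by (auto simp: swap_walks_def)
    show "pair_total (kron_matrix \<alpha> 1 0) L T (swap_walks k x)
        \<le> (walk_total (kron_matrix \<alpha> 1 0) L (swap_walks k x))\<^sup>2"
      if "x \<in> {0, 1}" "T \<subseteq> {..<L}" "T \<noteq> {}" for x T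
    proof (cases "x = 1")
      case True
      have "\<theta> * (walk_total P L (swap_walks k 1))\<^sup>2 \<le> 1 * (walk_total P L (swap_walks k 1))\<^sup>2"
        using \<theta>1 by (intro mult_right_mono) auto
      then show ?thesis using ratio[OF that(2,3)] unfolding P_def True by linarith
    next
      case False
      then have "x = 0" using that(1) by simp
      then show ?thesis using tot0 pair0[of T] unfolding P_def by simp
    qed
  qed (use \<theta>0 \<theta>1 ratio in \<open>auto simp: P_def\<close>)
qed

section \<open>The diameter\<close>

definition coin_graph :: "nat \<Rightarrow> ((nat \<Rightarrow> nat) set \<Rightarrow> bool) \<Rightarrow> (nat \<Rightarrow> nat) pair_pre_digraph" where
  "coin_graph n X = \<lparr>pverts = kron_verts n, parcs = kron_arcs n X\<rparr>"

lemma kronecker_graph_coins: "kronecker_graph n P = map_pmf (coin_graph n) (kron_coins n P)"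
  by (simp add: kronecker_graph_def kron_coins_def coin_graph_def[abs_def] kron_arcs_def)

lemma relpow_awalk:
  assumes "(u, v) \<in> kron_arcs n X ^^ k" "u \<in> kron_verts n"
  shows "\<exists>p. pre_digraph.awalk (with_proj (coin_graph n X)) u p v \<and> length p = k"
  using assms
proof (induction k arbitrary: u)
  case 0
  then show ?case
    by (intro exI[of _ "[]"]) (simp add: pre_digraph.awalk_def pre_digraph.cas.simps coin_graph_def)
next
  case (Suc k)
  obtain w where w: "(u, w) \<in> kron_arcs n X" "(w, v) \<in> kron_arcs n X ^^ k"
    using Suc.prems(1) by (meson relpow_Suc_E2)
  then have "w \<in> kron_verts n" by (simp add: kron_arcs_def)
  then obtain p where "pre_digraph.awalk (with_proj (coin_graph n X)) w p v" "length p = k"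
    using Suc.IH[OF w(2)] by blast
  then show ?case using w(1) Suc.prems(2)
    by (intro exI[of _ "(u, w) # p"]) (auto simp: pre_digraph.awalk_def coin_graph_def pre_digraph.cas.simps)
qed

text \<open>Two walks to \<open>h\<close> are concatenated, the second one reversed by the symmetry
  of the arcs.\<close>

lemma graph_diam_le_hub:
  assumes "\<And>u. u \<in> kron_verts n \<Longrightarrow> \<exists>k\<le>K. (u, h) \<in> kron_arcs n X ^^ k"
  shows "graph_diam (with_proj (coin_graph n X)) \<le> ereal (real (2 * K))"
  unfolding graph_diam_def
proof (intro SUP_least)
  fix u v assume uv: "u \<in> verts (with_proj (coin_graph n X))" "v \<in> verts (with_proj (coin_graph n X))"
  then have V: "u \<in> kron_verts n" "v \<in> kron_verts n" by (simp_all add: coin_graph_def)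
  obtain k where k: "k \<le> K" "(u, h) \<in> kron_arcs n X ^^ k" using assms[OF V(1)] by blast
  obtain l where l: "l \<le> K" "(v, h) \<in> kron_arcs n X ^^ l" using assms[OF V(2)] by blast
  have "(h, v) \<in> kron_arcs n X ^^ l" using l(2)
  proof (induction l arbitrary: v)
    case (Suc l)
    then obtain w where "(v, w) \<in> kron_arcs n X" "(w, h) \<in> kron_arcs n X ^^ l"
      by (meson relpow_Suc_E2)
    then show ?case using Suc.IH[of w] by (auto simp: kron_arcs_def insert_commute)
  qed simp
  then have "(u, v) \<in> kron_arcs n X ^^ (k + l)" using k(2) by (auto simp: relpow_add)
  then obtain p where p: "pre_digraph.awalk (with_proj (coin_graph n X)) u p v" "length p = k + l"
    using relpow_awalk[OF _ V(1)] by blast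
  have "wf_digraph (with_proj (coin_graph n X))"
    by unfold_locales (auto simp: coin_graph_def kron_arcs_def)
  then have "graph_dist (with_proj (coin_graph n X)) u v \<le> ereal (real (length p))"
    using p(1) by (auto simp: graph_dist_eq intro!: INF_lower)
  also have "\<dots> \<le> ereal (real (2 * K))" using k(1) l(1) p(2) by simp
  finally show "graph_dist (with_proj (coin_graph n X)) u v \<le> ereal (real (2 * K))" .
qed

lemma card_kron_verts: "card (kron_verts n) = 2 ^ n"
  by (simp add: kron_verts_def card_PiE numeral_2_eq_2)

text \<open>The union bound over the \<open>2 ^ n\<close> vertices leaves a failure probability of
  at most \<open>C * (1 / 2) ^ n\<close>.\<close>

lemma diam_bounded_aas:
  assumes reach: "\<And>n u. N \<le> n \<Longrightarrow> u \<in> kron_verts n \<Longrightarrow> measure_pmf.prob (kron_coins n P)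
      {X. \<not> (\<exists>k\<le>K. (u, kron_hub n) \<in> kron_arcs n X ^^ k)} \<le> C * (1 / 4) ^ n"
  shows "(\<lambda>n. measure_pmf.prob (kronecker_graph n P)
      {G. graph_diam (with_proj G) \<le> ereal (real (2 * K))}) \<longlonglongrightarrow> 1"
proof (rule tendsto_sandwich)
  let ?good = "\<lambda>n. {X. graph_diam (with_proj (coin_graph n X)) \<le> ereal (real (2 * K))}"
  let ?bad = "\<lambda>n u. {X. \<not> (\<exists>k\<le>K. (u, kron_hub n) \<in> kron_arcs n X ^^ k)}"
  have eq: "measure_pmf.prob (kronecker_graph n P) {G. graph_diam (with_proj G) \<le> ereal (real (2 * K))}
      = measure_pmf.prob (kron_coins n P) (?good n)" for n
    by (simp add: kronecker_graph_coins vimage_def)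
  have "1 - C * (1 / 2) ^ n \<le> measure_pmf.prob (kron_coins n P) (?good n)" if n: "N \<le> n" for n
  proof -
    have "- ?good n \<subseteq> (\<Union>u\<in>kron_verts n. ?bad n u)"
      using graph_diam_le_hub by blast
    then have "measure_pmf.prob (kron_coins n P) (- ?good n)
        \<le> measure_pmf.prob (kron_coins n P) (\<Union>u\<in>kron_verts n. ?bad n u)"
      by (intro measure_pmf.finite_measure_mono) auto
    also have "\<dots> \<le> (\<Sum>u\<in>kron_verts n. measure_pmf.prob (kron_coins n P) (?bad n u))"
      by (intro measure_pmf.finite_measure_subadditive_finite finite_kron_verts) auto
    also have "\<dots> \<le> (\<Sum>u\<in>kron_verts n. C * (1 / 4) ^ n)"
      by (intro sum_mono reach n)
    also have "\<dots> = C * (1 / 2) ^ n"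
      proof -
      have "(2 :: real) ^ n * (1 / 4) ^ n = (1 / 2) ^ n" by (simp flip: power_mult_distrib)
      then show ?thesis by (simp add: card_kron_verts mult.left_commute)
    qed
    finally show ?thesis
      using measure_pmf.prob_compl[of "?good n" "kron_coins n P"] by (simp add: Compl_eq_Diff_UNIV)
  qed
  then show "\<forall>\<^sub>F n in sequentially. 1 - C * (1 / 2) ^ n \<le> measure_pmf.prob (kronecker_graph n P)
      {G. graph_diam (with_proj G) \<le> ereal (real (2 * K))}"
    unfolding eq eventually_sequentially by blast
  show "\<forall>\<^sub>F n in sequentially. measure_pmf.prob (kronecker_graph n P)
      {G. graph_diam (with_proj G) \<le> ereal (real (2 * K))} \<le> 1"
    by simp
  have "(\<lambda>n. 1 - C * (1 / 2) ^ n) \<longlonglongrightarrow> 1 - C * 0"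
    by (intro tendsto_diff tendsto_mult tendsto_const LIMSEQ_power_zero) simp
  then show "(\<lambda>n. 1 - C * (1 / 2) ^ n) \<longlonglongrightarrow> 1" by simp
qed simp

text \<open>One family of walks fails with probability of order \<open>\<theta> ^ (n div 2)\<close>,
  so \<open>k\<close> independent families with \<open>\<theta> ^ k < 1 / 16\<close> fail together
  with probability of order \<open>(1 / 16) ^ (n div 2)\<close>, that is
  \<open>(1 / 4) ^ n\<close>.\<close>

lemma prob_not_reaching_hub_geometric:
  fixes Zf :: "nat \<Rightarrow> (nat \<Rightarrow> nat) set"
  assumes sym: "\<And>i j. P i j = P j i"
    and P: "\<And>i j. i \<in> {0, 1} \<Longrightarrow> j \<in> {0, 1} \<Longrightarrow> 0 \<le> Q i j \<and> Q i j \<le> P i j \<and> P i j \<le> 1"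
    and L: "3 \<le> L"
    and fin: "\<And>x. x \<in> {0, 1} \<Longrightarrow> finite (Zf x)"
    and Zf: "\<And>x z. x \<in> {0, 1} \<Longrightarrow> z \<in> Zf x \<Longrightarrow> z 0 = x \<and> z L = 1"
    and bin: "\<And>x z t. x \<in> {0, 1} \<Longrightarrow> z \<in> Zf x \<Longrightarrow> z t \<in> {0, 1}"
    and pos: "\<And>x. x \<in> {0, 1} \<Longrightarrow> walk_total Q L (Zf x) > 0"
    and ratio: "\<And>x T. x \<in> {0, 1} \<Longrightarrow> T \<subseteq> {..<L} \<Longrightarrow> T \<noteq> {} \<Longrightarrow>
        pair_total Q L T (Zf x) \<le> (walk_total Q L (Zf x))\<^sup>2"
    and ratio_c: "\<And>T. T \<subseteq> {..<L} \<Longrightarrow> T \<noteq> {} \<Longrightarrow>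
        pair_total Q L T (Zf c) \<le> \<theta> * (walk_total Q L (Zf c))\<^sup>2"
    and \<theta>: "0 < \<theta>" "\<theta> < 1"
    and c: "c \<in> {0, 1}"
    and m: "0 < m" "m \<le> Q c 1" "m \<le> Q c 0" "m \<le> Q 1 1" "m \<le> Q 1 0" "m \<le> Q 0 1"
  obtains C N where "0 \<le> C" "\<And>n u. N \<le> n \<Longrightarrow> u \<in> kron_verts n \<Longrightarrow> u \<noteq> kron_hub n \<Longrightarrow>
      n div 2 \<le> card {i \<in> {1..n}. u i = c} \<Longrightarrow>
      measure_pmf.prob (kron_coins n P) {X. (u, kron_hub n) \<notin> kron_arcs n X ^^ L} \<le> C * (1 / 4) ^ n"
proof -
  have "(\<lambda>k. \<theta> ^ k) \<longlonglongrightarrow> 0" using \<theta> by (intro LIMSEQ_power_zero) simp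
  then have "eventually (\<lambda>k. \<theta> ^ k < 1 / 16) sequentially" by (rule order_tendstoD(2)) simp
  then have "eventually (\<lambda>k. \<theta> ^ k < 1 / 16 \<and> 1 \<le> k) sequentially"
    by (intro eventually_conj eventually_ge_at_top)
  then have "\<exists>k. \<theta> ^ k < 1 / 16 \<and> 1 \<le> k" by (rule eventually_happens'[OF sequentially_bot])
  then obtain k where k: "\<theta> ^ k < 1 / 16" "1 \<le> k" by blast
  define d where "d = k * (L - 1)"
  have "1 * 2 \<le> k * (L - 1)" using k(2) L by (intro mult_le_mono) auto
  then have d: "2 \<le> k * (L - 1)" by simp
  define A where "A = 2 ^ L * ((1 / m) ^ L) ^ d"
  have A: "0 \<le> A" unfolding A_def using m(1) by simp
  show thesis
  \<comment> \<open>In the constant, \<open>16 ^ d\<close> pays for the \<open>d\<close> label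
    coordinates and 4 for the rounding in \<open>n div 2\<close>. The threshold \<open>2 * d\<close>
    leaves room for the labels.\<close>
  proof (rule that[of "A ^ k * 16 ^ d * 4" "2 * d"])
    show "0 \<le> A ^ k * 16 ^ d * 4" using A by simp
    fix n u assume n: "2 * d \<le> n" and u: "u \<in> kron_verts n" "u \<noteq> kron_hub n"
      "n div 2 \<le> card {i \<in> {1..n}. u i = c}"
    have dn: "d \<le> n div 2" using n by linarith
    have "measure_pmf.prob (kron_coins n P) {X. (u, kron_hub n) \<notin> kron_arcs n X ^^ L}
      \<le> (2 ^ L * ((1 / m) ^ L) ^ (k * (L - 1)) * \<theta> ^ (n div 2 - k * (L - 1))) ^ k"
    proof (rule prob_not_reaching_hub[where Zf = Zf and c = c and Q = Q])
      show "P i j = P j i" for i j by (rule sym)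
      show "0 \<le> Q i j \<and> Q i j \<le> P i j \<and> P i j \<le> 1" if "i \<in> {0, 1}" "j \<in> {0, 1}" for i j
        by (rule P[OF that])
      show "z 0 = x \<and> z L = 1" if "x \<in> {0, 1}" "z \<in> Zf x" for x z by (rule Zf[OF that])
      show "z t \<in> {0, 1}" if "x \<in> {0, 1}" "z \<in> Zf x" for x z t by (rule bin[OF that])
      show "2 \<le> L" "0 < k" "\<theta> \<le> 1" using L k(2) \<theta>(2) by simp_all
      show "k * (L - 1) \<le> n div 2" using dn by (simp add: d_def)
      show "walk_total Q L (Zf x) > 0" if "x \<in> {0, 1}" for x by (rule pos[OF that])
      show "finite (Zf x)" if "x \<in> {0, 1}" for x by (rule fin[OF that])
      show "pair_total Q L T (Zf x) \<le> (walk_total Q L (Zf x))\<^sup>2"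
        if "x \<in> {0, 1}" "T \<subseteq> {..<L}" "T \<noteq> {}" for x T by (rule ratio[OF that])
      show "pair_total Q L T (Zf c) \<le> \<theta> * (walk_total Q L (Zf c))\<^sup>2"
        if "T \<subseteq> {..<L}" "T \<noteq> {}" for T by (rule ratio_c[OF that])
    qed (rule d \<theta>(1) c m u)+
    also have "\<dots> = A ^ k * (\<theta> ^ k) ^ (n div 2 - d)"
      by (simp add: A_def d_def power_mult_distrib power_mult[symmetric] mult.commute)
    also have "\<dots> \<le> A ^ k * (1 / 16) ^ (n div 2 - d)"
      using k(1) \<theta>(1) A by (intro mult_left_mono power_mono) auto
    also have "(1 / 16 :: real) ^ (n div 2 - d) = 16 ^ d * (1 / 4) ^ (2 * (n div 2))"
      using dn by (simp add: power_diff power_mult power2_eq_square field_simps)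
    also have "(1 / 4 :: real) ^ (2 * (n div 2)) \<le> 4 * (1 / 4) ^ n"
    proof -
      have "(1 / 4 :: real) ^ (Suc (2 * (n div 2))) \<le> (1 / 4) ^ n"
        by (rule power_decreasing) auto
      then show ?thesis by simp
    qed
    finally show "measure_pmf.prob (kron_coins n P) {X. (u, kron_hub n) \<notin> kron_arcs n X ^^ L}
        \<le> A ^ k * 16 ^ d * 4 * (1 / 4) ^ n"
      using A by (simp add: mult_left_mono mult.assoc)
  qed
qed

section \<open>The two parameter regimes\<close>

lemma card_ones_zeros:
  assumes "u \<in> kron_verts n"
  shows "card {i \<in> {1..n}. u i = 0} + card {i \<in> {1..n}. u i = 1} = n"
proof -
  have "{i \<in> {1..n}. u i = 0} \<union> {i \<in> {1..n}. u i = 1} = {1..n}"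
    using assms by (auto simp: kron_verts_def)
  moreover have "card ({i \<in> {1..n}. u i = 0} \<union> {i \<in> {1..n}. u i = 1})
      = card {i \<in> {1..n}. u i = 0} + card {i \<in> {1..n}. u i = 1}"
    by (rule card_Un_disjoint) auto
  ultimately show ?thesis by simp
qed

lemma prob_not_within_le:
  assumes "0 \<le> b" "u \<noteq> kron_hub n \<Longrightarrow> measure_pmf.prob (kron_coins n P) {X. (u, kron_hub n) \<notin> kron_arcs n X ^^ L} \<le> b"
  shows "measure_pmf.prob (kron_coins n P) {X. \<not> (\<exists>k\<le>L. (u, kron_hub n) \<in> kron_arcs n X ^^ k)} \<le> b"
proof (cases "u = kron_hub n")
  case True
  then have "{X. \<not> (\<exists>k\<le>L. (u, kron_hub n) \<in> kron_arcs n X ^^ k)} = {}" by (auto intro!: exI[of _ 0])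
  then show ?thesis using assms(1) by (simp only: measure_empty)
next
  case False
  have "measure_pmf.prob (kron_coins n P) {X. \<not> (\<exists>k\<le>L. (u, kron_hub n) \<in> kron_arcs n X ^^ k)}
      \<le> measure_pmf.prob (kron_coins n P) {X. (u, kron_hub n) \<notin> kron_arcs n X ^^ L}"
    by (rule measure_pmf.finite_measure_mono) auto
  then show ?thesis using assms(2)[OF False] by linarith
qed

text \<open>The walks are weighted by \<open>Q\<close>, in which \<alpha> is lowered to \<gamma>.
  Every vertex has the value 0 or the value 1 in at least \<open>n div 2\<close> coordinates, and
  the ratio bound with \<open>\<theta>\<close> holds for both starting values.\<close>

lemma diam_bounded_expanding:
  fixes \<alpha> \<beta> \<gamma> :: real
  assumes "\<alpha> \<le> 1" "\<beta> \<le> 1" "\<gamma> \<le> \<alpha>" "\<beta> + \<gamma> > 1"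
  shows "\<exists>a::real. (\<lambda>n. measure_pmf.prob (kronecker_graph n (kron_matrix \<alpha> \<beta> \<gamma>))
           {G. graph_diam (with_proj G) \<le> ereal a}) \<longlonglongrightarrow> 1"
proof -
  define P where "P = kron_matrix \<alpha> \<beta> \<gamma>"
  define Q where "Q = kron_matrix \<gamma> \<beta> \<gamma>"
  define m where "m = min \<beta> \<gamma>"
  have pos: "0 < \<beta>" "0 < \<gamma>" "\<gamma> \<le> 1" using assms by linarith+
  obtain L \<theta> where L: "3 \<le> L" and \<theta>: "0 < \<theta>" "\<theta> < 1"
    and tot: "\<And>x. x \<in> {0, 1} \<Longrightarrow> walk_total Q L (bin_walks L x) > 0"
    and ratio: "\<And>x T. x \<in> {0, 1} \<Longrightarrow> T \<subseteq> {..<L} \<Longrightarrow> T \<noteq> {} \<Longrightarrow>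
      pair_total Q L T (bin_walks L x) \<le> \<theta> * (walk_total Q L (bin_walks L x))\<^sup>2"
    by (rule expanding_bridges[OF pos(1,2) assms(4), folded Q_def]) blast
  have sym: "P i j = P j i" for i j unfolding P_def by (rule kron_matrix_sym)
  have PQ: "0 \<le> Q i j \<and> Q i j \<le> P i j \<and> P i j \<le> 1" for i j
    using assms pos by (auto simp: P_def Q_def kron_matrix_def)
  have mQ: "m \<le> Q i j" for i j by (auto simp: Q_def kron_matrix_def m_def)
  have m0: "0 < m" using pos by (simp add: m_def)
  have ratio1: "pair_total Q L T (bin_walks L x) \<le> (walk_total Q L (bin_walks L x))\<^sup>2"
    if "x \<in> {0, 1}" "T \<subseteq> {..<L}" "T \<noteq> {}" for x T
  proof -
    have "\<theta> * (walk_total Q L (bin_walks L x))\<^sup>2 \<le> 1 * (walk_total Q L (bin_walks L x))\<^sup>2"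
      using \<theta> by (intro mult_right_mono) auto
    then show ?thesis using ratio[OF that] by linarith
  qed
  have hub: "\<exists>C N. 0 \<le> C \<and> (\<forall>n u. N \<le> n \<longrightarrow> u \<in> kron_verts n \<longrightarrow> u \<noteq> kron_hub n \<longrightarrow>
      n div 2 \<le> card {i \<in> {1..n}. u i = c} \<longrightarrow>
      measure_pmf.prob (kron_coins n P) {X. (u, kron_hub n) \<notin> kron_arcs n X ^^ L} \<le> C * (1 / 4) ^ n)"
    if c: "c \<in> {0, 1}" for c
  proof (rule prob_not_reaching_hub_geometric[where Zf = "bin_walks L" and c = c and Q = Q and P = P and L = L and m = m and \<theta> = \<theta>])
    show "P i j = P j i" for i j by (rule sym)
    show "0 \<le> Q i j \<and> Q i j \<le> P i j \<and> P i j \<le> 1" for i j by (rule PQ)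
    show "z 0 = x \<and> z L = 1" if "z \<in> bin_walks L x" for x z by (rule bin_walks_ends[OF that])
    show "z t \<in> {0, 1}" if "x \<in> {0, 1}" "z \<in> bin_walks L x" for x z t
      by (rule bin_walks_binary[OF that(2,1)])
    show "pair_total Q L T (bin_walks L c) \<le> \<theta> * (walk_total Q L (bin_walks L c))\<^sup>2"
      if "T \<subseteq> {..<L}" "T \<noteq> {}" for T by (rule ratio[OF c that])
    show "walk_total Q L (bin_walks L x) > 0" if "x \<in> {0, 1}" for x by (rule tot[OF that])
    show "pair_total Q L T (bin_walks L x) \<le> (walk_total Q L (bin_walks L x))\<^sup>2"
      if "x \<in> {0, 1}" "T \<subseteq> {..<L}" "T \<noteq> {}" for x T by (rule ratio1[OF that])
  qed (rule L finite_bin_walks \<theta> c mQ m0 | blast)+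
  obtain C0 N0 where C0: "0 \<le> C0" and far0: "\<And>n u. N0 \<le> n \<Longrightarrow> u \<in> kron_verts n \<Longrightarrow> u \<noteq> kron_hub n \<Longrightarrow>
      n div 2 \<le> card {i \<in> {1..n}. u i = 0} \<Longrightarrow>
      measure_pmf.prob (kron_coins n P) {X. (u, kron_hub n) \<notin> kron_arcs n X ^^ L} \<le> C0 * (1 / 4) ^ n"
    using hub[of 0] by auto
  obtain C1 N1 where C1: "0 \<le> C1" and far1: "\<And>n u. N1 \<le> n \<Longrightarrow> u \<in> kron_verts n \<Longrightarrow> u \<noteq> kron_hub n \<Longrightarrow>
      n div 2 \<le> card {i \<in> {1..n}. u i = 1} \<Longrightarrow>
      measure_pmf.prob (kron_coins n P) {X. (u, kron_hub n) \<notin> kron_arcs n X ^^ L} \<le> C1 * (1 / 4) ^ n"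
    using hub[of 1] by auto
  have "measure_pmf.prob (kron_coins n P) {X. \<not> (\<exists>k\<le>L. (u, kron_hub n) \<in> kron_arcs n X ^^ k)}
      \<le> (C0 + C1) * (1 / 4) ^ n"
    if n: "max N0 N1 \<le> n" and u: "u \<in> kron_verts n" for n u
  proof (rule prob_not_within_le)
    show "0 \<le> (C0 + C1) * (1 / 4) ^ n" using C0 C1 by simp
    assume hub: "u \<noteq> kron_hub n"
    have "0 \<le> C0 * (1 / 4) ^ n" "0 \<le> C1 * (1 / 4) ^ n" using C0 C1 by simp_all
    moreover have "n div 2 \<le> card {i \<in> {1..n}. u i = 0} \<or> n div 2 \<le> card {i \<in> {1..n}. u i = 1}"
      using card_ones_zeros[OF u] by linarith
    ultimately show "measure_pmf.prob (kron_coins n P) {X. (u, kron_hub n) \<notin> kron_arcs n X ^^ L}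
        \<le> (C0 + C1) * (1 / 4) ^ n"
      using far0[OF _ u hub] far1[OF _ u hub] n unfolding distrib_right by fastforce
  qed
  then show ?thesis unfolding P_def[symmetric]
    by (intro exI[of _ "real (2 * L)"]) (rule diam_bounded_aas)
qed

text \<open>Only coordinates starting at 1 provide a ratio below 1. A vertex with too few ones
  therefore first moves to its complement, along an edge whose probability is a product of factors
  \<beta> = 1.\<close>

lemma diam_bounded_swapping:
  fixes \<alpha> :: real
  assumes \<alpha>: "0 < \<alpha>" "\<alpha> \<le> 1"
  shows "\<exists>a::real. (\<lambda>n. measure_pmf.prob (kronecker_graph n (kron_matrix \<alpha> 1 0))
           {G. graph_diam (with_proj G) \<le> ereal a}) \<longlonglongrightarrow> 1"
proof -
  define P where "P = kron_matrix \<alpha> 1 0"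
  obtain L k \<theta> where L: "3 \<le> L" and \<theta>: "0 < \<theta>" "\<theta> < 1"
    and ends: "\<And>x z. x \<in> {0, 1} \<Longrightarrow> z \<in> swap_walks k x \<Longrightarrow> z 0 = x \<and> z L = 1"
    and tot: "\<And>x. x \<in> {0, 1} \<Longrightarrow> walk_total P L (swap_walks k x) > 0"
    and ratio1: "\<And>x T. x \<in> {0, 1} \<Longrightarrow> T \<subseteq> {..<L} \<Longrightarrow> T \<noteq> {} \<Longrightarrow>
      pair_total P L T (swap_walks k x) \<le> (walk_total P L (swap_walks k x))\<^sup>2"
    and ratio: "\<And>T. T \<subseteq> {..<L} \<Longrightarrow> T \<noteq> {} \<Longrightarrow>
      pair_total P L T (swap_walks k 1) \<le> \<theta> * (walk_total P L (swap_walks k 1))\<^sup>2"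
    by (rule swapping_bridges[OF \<alpha>, folded P_def]) blast
  have sym: "P i j = P j i" for i j unfolding P_def by (rule kron_matrix_sym)
  have P01: "0 \<le> P i j \<and> P i j \<le> P i j \<and> P i j \<le> 1" for i j
    using \<alpha> by (auto simp: P_def kron_matrix_def)
  obtain C N where C: "0 \<le> C"
    and CN: "\<And>n u. N \<le> n \<Longrightarrow> u \<in> kron_verts n \<Longrightarrow> u \<noteq> kron_hub n \<Longrightarrow>
      n div 2 \<le> card {i \<in> {1..n}. u i = 1} \<Longrightarrow>
      measure_pmf.prob (kron_coins n P) {X. (u, kron_hub n) \<notin> kron_arcs n X ^^ L} \<le> C * (1 / 4) ^ n"
  proof (rule prob_not_reaching_hub_geometric[where Zf = "swap_walks k" and c = 1 and Q = P and P = P and L = L and m = \<alpha> and \<theta> = \<theta>])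
    show "P i j = P j i" for i j by (rule sym)
    show "0 \<le> P i j \<and> P i j \<le> P i j \<and> P i j \<le> 1" for i j by (rule P01)
    show "z 0 = x \<and> z L = 1" if "x \<in> {0, 1}" "z \<in> swap_walks k x" for x z by (rule ends[OF that])
    show "z t \<in> {0, 1}" if "z \<in> swap_walks k x" for x z t
      using that by (auto simp: swap_walks_def shift_walk_def split: if_splits)
    show "finite (swap_walks k x)" for x by (simp add: swap_walks_def)
    show "\<alpha> \<le> P 1 1" "\<alpha> \<le> P 1 0" "\<alpha> \<le> P 0 1" "\<alpha> \<le> P 1 1" "\<alpha> \<le> P 1 0"
      using \<alpha> by (auto simp: P_def kron_matrix_def)
    show "(1::nat) \<in> {0, 1}" by simp
    show "walk_total P L (swap_walks k x) > 0" if "x \<in> {0, 1}" for x by (rule tot[OF that])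
    show "pair_total P L T (swap_walks k x) \<le> (walk_total P L (swap_walks k x))\<^sup>2"
      if "x \<in> {0, 1}" "T \<subseteq> {..<L}" "T \<noteq> {}" for x T by (rule ratio1[OF that])
    show "pair_total P L T (swap_walks k 1) \<le> \<theta> * (walk_total P L (swap_walks k 1))\<^sup>2"
      if "T \<subseteq> {..<L}" "T \<noteq> {}" for T by (rule ratio[OF that])
  qed (rule L \<theta> \<alpha>(1) | blast)+
  \<comment> \<open>The additional step is the move to the complement; \<open>1 \<le> n\<close>
    makes the complement a different vertex.\<close>
  have "measure_pmf.prob (kron_coins n P) {X. \<not> (\<exists>k\<le>Suc L. (u, kron_hub n) \<in> kron_arcs n X ^^ k)}
      \<le> C * (1 / 4) ^ n"
    if n: "max N 1 \<le> n" and u: "u \<in> kron_verts n" for n u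
  proof (cases "n div 2 \<le> card {i \<in> {1..n}. u i = 1}")
    case True
    have "measure_pmf.prob (kron_coins n P) {X. \<not> (\<exists>k\<le>Suc L. (u, kron_hub n) \<in> kron_arcs n X ^^ k)}
      \<le> measure_pmf.prob (kron_coins n P) {X. \<not> (\<exists>k\<le>L. (u, kron_hub n) \<in> kron_arcs n X ^^ k)}"
      by (rule measure_pmf.finite_measure_mono) (auto intro: le_SucI)
    also have "\<dots> \<le> C * (1 / 4) ^ n"
      by (rule prob_not_within_le) (use C CN[OF _ u _ True] n in auto)
    finally show ?thesis .
  next
    case False
    define v where "v = (\<lambda>i\<in>{1..n}. 1 - u i)"
    have v: "v \<in> kron_verts n" by (auto simp: v_def kron_verts_def)
    have ui: "u i \<in> {0, 1}" if "i \<in> {1..n}" for i using u that by (auto simp: kron_verts_def)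
    have vi: "v i = 1 - u i" if "i \<in> {1..n}" for i using that by (simp add: v_def)
    have "{i \<in> {1..n}. v i = 1} = {i \<in> {1..n}. u i = 0}"
      using ui vi by fastforce
    then have many: "n div 2 \<le> card {i \<in> {1..n}. v i = 1}"
      using card_ones_zeros[OF u] False by simp
    have uv: "u \<noteq> v"
    proof
      assume "u = v"
      then show False using ui[of 1] vi[of 1] n by auto
    qed
    let ?e = "{u, v}"
    have "kron_prob n P ?e = (\<Prod>i\<in>{1..n}. P (u i) (v i))"
      by (rule kron_prob_doubleton[OF sym])
    also have "\<dots> = 1"
      using ui vi by (intro prod.neutral) (force simp: P_def kron_matrix_def)
    finally have "kron_prob n P ?e = 1" .
    then have "measure_pmf.prob (kron_coins n P) {X. \<forall>e\<in>{?e}. X e} = 1"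
      unfolding kron_coins_def
      by (subst prob_all_Pi_bernoulli)
        (use kron_pairsI[OF u v uv] finite_kron_pairs kron_prob_bounds[OF sym] P01 in auto)
    then have sure: "measure_pmf.prob (kron_coins n P) {X. \<not> X ?e} = 0"
      using measure_pmf.prob_compl[of "{X. X ?e}" "kron_coins n P"] by (simp add: Collect_neg_eq Compl_eq_Diff_UNIV)
    have "{X. \<not> (\<exists>k\<le>Suc L. (u, kron_hub n) \<in> kron_arcs n X ^^ k)}
        \<subseteq> {X. \<not> X ?e} \<union> {X. \<not> (\<exists>k\<le>L. (v, kron_hub n) \<in> kron_arcs n X ^^ k)}"
    proof
      fix X assume X: "X \<in> {X. \<not> (\<exists>k\<le>Suc L. (u, kron_hub n) \<in> kron_arcs n X ^^ k)}"
      have False if e: "X ?e" and k: "k \<le> L" "(v, kron_hub n) \<in> kron_arcs n X ^^ k" for k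
      proof -
        have "(u, v) \<in> kron_arcs n X" using e u v uv by (simp add: kron_arcs_def)
        then have "(u, kron_hub n) \<in> kron_arcs n X ^^ Suc k" using k(2) by (rule relpow_Suc_I2)
        then show False using X k(1) by blast
      qed
      then show "X \<in> {X. \<not> X ?e} \<union> {X. \<not> (\<exists>k\<le>L. (v, kron_hub n) \<in> kron_arcs n X ^^ k)}" by blast
    qed
    then have "measure_pmf.prob (kron_coins n P) {X. \<not> (\<exists>k\<le>Suc L. (u, kron_hub n) \<in> kron_arcs n X ^^ k)}
        \<le> measure_pmf.prob (kron_coins n P) ({X. \<not> X ?e} \<union> {X. \<not> (\<exists>k\<le>L. (v, kron_hub n) \<in> kron_arcs n X ^^ k)})"
      by (intro measure_pmf.finite_measure_mono) auto
    also have "\<dots> \<le> measure_pmf.prob (kron_coins n P) {X. \<not> X ?e}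
        + measure_pmf.prob (kron_coins n P) {X. \<not> (\<exists>k\<le>L. (v, kron_hub n) \<in> kron_arcs n X ^^ k)}"
      by (rule measure_Un_le) auto
    also have "\<dots> \<le> 0 + C * (1 / 4) ^ n"
    proof (rule add_mono)
      show "measure_pmf.prob (kron_coins n P) {X. \<not> (\<exists>k\<le>L. (v, kron_hub n) \<in> kron_arcs n X ^^ k)} \<le> C * (1 / 4) ^ n"
        by (rule prob_not_within_le) (use C CN[OF _ v _ many] n in auto)
    qed (simp add: sure)
    finally show ?thesis by simp
  qed
  then show ?thesis unfolding P_def[symmetric]
    by (intro exI[of _ "real (2 * Suc L)"]) (rule diam_bounded_aas)
qed

theorem theorem2:
  fixes \<alpha> \<beta> \<gamma> :: real
  assumes "\<alpha> \<in> {0..1}" and "\<beta> \<in> {0..1}" and "\<gamma> \<in> {0..1}"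
    and "\<alpha> \<ge> \<gamma>"
    and "\<beta> + \<gamma> > 1 \<or> (\<beta> = 1 \<and> \<alpha> > 0 \<and> \<gamma> = 0)"
  shows "\<exists>a::real.
    (\<lambda>n. measure_pmf.prob (kronecker_graph n (kron_matrix \<alpha> \<beta> \<gamma>))
           {G. graph_diam (with_proj G) \<le> ereal a}) \<longlonglongrightarrow> 1"
  using assms(5)
proof
  assume "\<beta> + \<gamma> > 1"
  then show ?thesis using assms(1-4) by (intro diam_bounded_expanding) auto
next
  assume h: "\<beta> = 1 \<and> \<alpha> > 0 \<and> \<gamma> = 0"
  then show ?thesis using diam_bounded_swapping[of \<alpha>] assms(1) by simp
qed

end
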